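(* Let $p$ be a prime with $p \equiv 1 \pmod 4$. Let $A$ be a degenerate quadratic space over $\mathbb{Q}_p$ that is isometrically isomorphic to $\mathrm{diag}(0^{k}) \oplus S$, where $S$ is a nondegenerate quadratic space over $\mathbb{Q}_p$, and let $n$ be a positive integer. Then $A$ is embedded in $\mathrm{diag}(1^{n})$ if and only if $S$ is embedded in $\mathrm{diag}(1^{n-2k})$.
   Context: A quadratic space over $\mathbb{Q}_p$ is a finite-dimensional $\mathbb{Q}_p$-vector space $V$ with a quadratic form $Q$ (possibly degenerate, i.e. its associated symmetric bilinear form $B$ may have nonzero radical). For $a_1,\dots,a_n \in \mathbb{Q}_p$, $\mathrm{diag}(a_1,\dots,a_n)$ denotes the space $\mathbb{Q}_p^n$ with the form $a_1x_1^2+\cdots+a_nx_n^2$; $\mathrm{diag}(a^k)$ means $a$ repeated $k$ times. So $\mathrm{diag}(0^k)$ is the $k$-dimensional space with zero form, and $\mathrm{diag}(1^n)$ is $(\mathbb{Q}_p^n, x_1^2+\cdots+x_n^2)$. $\oplus$ is the orthogonal direct sum. A quadratic space $(V,Q)$ is embedded in $(V',Q')$ if there is an injective linear map $f:V\to V'$ with $Q'(f(v))=Q(v)$ for all $v\in V$. Since $A$ is degenerate, $k\ge 1$. The zero space is allowed as $S$. If $n-2k<0$, the statement "$S$ is embedded in $\mathrm{diag}(1^{n-2k})$" is understood to be false; $\mathrm{diag}(1^0)$ is the zero space. *)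

theory Defs
  imports Complex_Main "HOL-Computational_Algebra.Primes" "HOL-Algebra.QuotRing"
    "Jordan_Normal_Form.Missing_VectorSpace"
begin

section \<open>The field of p-adic numbers\<close>

text \<open>The absolute value \<open>p\<close> to the power \<open>- v\<^sub>p(x)\<close> on the rationals.\<close>

definition padic_abs :: "nat \<Rightarrow> rat \<Rightarrow> real" where
  "padic_abs p x =
     (if x = 0 then 0
      else real p powi (int (multiplicity (int p) (snd (quotient_of x)))
                      - int (multiplicity (int p) (fst (quotient_of x)))))"

definition padic_Cauchy :: "nat \<Rightarrow> (nat \<Rightarrow> rat) \<Rightarrow> bool" where
  "padic_Cauchy p s \<longleftrightarrow>
     (\<forall>e>0. \<exists>N. \<forall>m\<ge>N. \<forall>n\<ge>N. padic_abs p (s m - s n) < e)"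

text \<open>Null sequences are Cauchy for prime \<open>p\<close>, by the triangle inequality.\<close>

definition padic_null :: "nat \<Rightarrow> (nat \<Rightarrow> rat) set" where
  "padic_null p = {s. (\<lambda>n. padic_abs p (s n)) \<longlonglongrightarrow> 0}"

definition padic_Cauchy_ring :: "nat \<Rightarrow> (nat \<Rightarrow> rat) ring" where
  "padic_Cauchy_ring p =
     \<lparr>carrier = {s. padic_Cauchy p s},
      mult = (\<lambda>s t n. s n * t n), one = (\<lambda>n. 1),
      zero = (\<lambda>n. 0), add = (\<lambda>s t n. s n + t n)\<rparr>"

type_synonym padic = "(nat \<Rightarrow> rat) set"

definition Qp :: "nat \<Rightarrow> padic ring" where
  "Qp p = padic_Cauchy_ring p Quot padic_null p"

lemma padic_abs_zero [simp]: "padic_abs p 0 = 0"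
  by (simp add: padic_abs_def)

context
  fixes p :: nat
  assumes p: "prime p"
begin

lemma padic_prime_elem: "prime_elem (int p)" "prime (int p)"
  using p by auto

lemma padic_prime_gt_1: "real p > 1"
  using prime_gt_1_nat[OF p] by simp

lemma padic_multiplicity_mult: "a \<noteq> 0 \<Longrightarrow> b \<noteq> 0 \<Longrightarrow>
    multiplicity (int p) (a * b) = multiplicity (int p) a + multiplicity (int p) b"
  using prime_elem_multiplicity_mult_distrib[OF padic_prime_elem(1)] by simp

lemma padic_abs_frac:
  assumes "a \<noteq> 0" "b \<noteq> 0"
  shows "padic_abs p (of_int a / of_int b) =
    real p powi (int (multiplicity (int p) b) - int (multiplicity (int p) a))"
proof -
  obtain c d where q: "quotient_of (of_int a / of_int b) = (c, d)" by force
  have d: "d > 0" using quotient_of_denom_pos[OF q] .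
  have eq: "(of_int a / of_int b :: rat) = of_int c / of_int d"
    using quotient_of_div[OF q] .
  hence "(of_int (a * d) :: rat) = of_int (c * b)"
    using assms d by (simp add: field_simps)
  hence e: "a * d = c * b" using of_int_eq_iff by blast
  have c: "c \<noteq> 0" using e assms d by auto
  have "multiplicity (int p) a + multiplicity (int p) d = multiplicity (int p) c + multiplicity (int p) b"
    using padic_multiplicity_mult[of a d] padic_multiplicity_mult[of c b] e c d assms by simp
  hence "int (multiplicity (int p) b) - int (multiplicity (int p) a) =
    int (multiplicity (int p) d) - int (multiplicity (int p) c)" by linarith
  moreover have "(of_int a / of_int b :: rat) \<noteq> 0" using assms by simp
  ultimately show ?thesis unfolding padic_abs_def q by simp
qed

lemma rat_as_fraction: obtains a b where "(x::rat) = of_int a / of_int b" "b \<noteq> 0"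
  using quotient_of_div[of x] quotient_of_denom_pos'[of x]
  by (metis less_irrefl prod.exhaust_sel)

lemma padic_abs_nonneg [simp]: "padic_abs p x \<ge> 0"
  using padic_prime_gt_1 by (auto simp: padic_abs_def)

lemma padic_abs_pos: "x \<noteq> 0 \<Longrightarrow> padic_abs p x > 0"
  using padic_prime_gt_1 by (auto simp: padic_abs_def)

lemma padic_abs_eq_0 [simp]: "padic_abs p x = 0 \<longleftrightarrow> x = 0"
  using padic_abs_pos[of x] by (cases "x = 0") auto

lemma padic_abs_mult: "padic_abs p (x * y) = padic_abs p x * padic_abs p y"
proof (cases "x = 0 \<or> y = 0")
  case False
  obtain a b where x: "x = of_int a / of_int b" "b \<noteq> 0" by (rule rat_as_fraction)
  obtain c d where y: "y = of_int c / of_int d" "d \<noteq> 0" by (rule rat_as_fraction)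
  have nz: "a \<noteq> 0" "c \<noteq> 0" using False x y by auto
  have xy: "x * y = of_int (a * c) / of_int (b * d)" using x y by simp
  have "padic_abs p (x * y) = real p powi (int (multiplicity (int p) (b*d)) - int (multiplicity (int p) (a*c)))"
    unfolding xy using nz x y by (intro padic_abs_frac) auto
  also have "int (multiplicity (int p) (b*d)) - int (multiplicity (int p) (a*c)) =
     (int (multiplicity (int p) b) - int (multiplicity (int p) a)) +
     (int (multiplicity (int p) d) - int (multiplicity (int p) c))"
    using nz x y by (simp add: padic_multiplicity_mult)
  also have "real p powi \<dots> = padic_abs p x * padic_abs p y"
    using padic_prime_gt_1 nz x y by (simp add: power_int_add padic_abs_frac)
  finally show ?thesis .
qed auto

lemma padic_abs_1 [simp]: "padic_abs p 1 = 1"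
  using padic_abs_frac[of 1 1] by simp

lemma padic_abs_minus [simp]: "padic_abs p (- x) = padic_abs p x"
proof -
  have "padic_abs p (-1) ^ 2 = 1"
    using padic_abs_mult[of "-1" "-1"] by (simp add: power2_eq_square)
  hence "padic_abs p (-1) = 1"
    using padic_abs_nonneg[of "-1"] by (auto simp: power2_eq_1_iff)
  thus ?thesis using padic_abs_mult[of "-1" x] by simp
qed

lemma padic_abs_diff_comm: "padic_abs p (x - y) = padic_abs p (y - x)"
  using padic_abs_minus[of "x - y"] by simp

lemma padic_abs_add: "padic_abs p (x + y) \<le> max (padic_abs p x) (padic_abs p y)"
proof (cases "x = 0 \<or> y = 0 \<or> x + y = 0")
  case False
  obtain a b where x: "x = of_int a / of_int b" "b \<noteq> 0" by (rule rat_as_fraction)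
  obtain c d where y: "y = of_int c / of_int d" "d \<noteq> 0" by (rule rat_as_fraction)
  define A C where "A = a * d" and "C = c * b"
  define v where "v = multiplicity (int p)"
  have x': "x = of_int A / of_int (b * d)" and y': "y = of_int C / of_int (b * d)"
    using x y by (auto simp: A_def C_def)
  have xy: "x + y = of_int (A + C) / of_int (b * d)"
    unfolding x' y' by (simp add: add_divide_distrib)
  have nz: "A \<noteq> 0" "C \<noteq> 0" "A + C \<noteq> 0" "b * d \<noteq> 0"
    using False xy x y x' y' by auto
  have "int p ^ min (v A) (v C) dvd A + C"
    unfolding v_def by (intro dvd_add multiplicity_dvd') auto
  hence "min (v A) (v C) \<le> v (A + C)"
    unfolding v_def using nz padic_prime_elem by (intro multiplicity_geI) auto
  hence "int (v (b*d)) - int (v (A + C)) \<le> int (v (b*d)) - int (v A) \<or>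
         int (v (b*d)) - int (v (A + C)) \<le> int (v (b*d)) - int (v C)"
    by linarith
  hence "padic_abs p (x + y) \<le> padic_abs p x \<or> padic_abs p (x + y) \<le> padic_abs p y"
    unfolding xy unfolding x' y' padic_abs_frac[OF nz(1,4)] padic_abs_frac[OF nz(2,4)]
      padic_abs_frac[OF nz(3,4)] v_def[symmetric]
    using padic_prime_gt_1 by (auto intro: power_int_increasing)
  thus ?thesis by auto
qed (auto simp: le_max_iff_disj)

lemma padic_abs_triangle: "padic_abs p (x + y) \<le> padic_abs p x + padic_abs p y"
  using padic_abs_add[of x y] padic_abs_nonneg[of x] padic_abs_nonneg[of y] by linarith

lemma padic_abs_triangle_minus: "padic_abs p (x - y) \<le> padic_abs p x + padic_abs p y"
  using padic_abs_triangle[of x "- y"] by simp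

lemma padic_Cauchy_bounded:
  assumes "padic_Cauchy p s"
  obtains B where "B > 0" "\<And>n. padic_abs p (s n) \<le> B"
proof -
  have "\<exists>N. \<forall>m\<ge>N. \<forall>n\<ge>N. padic_abs p (s m - s n) < 1"
    using assms unfolding padic_Cauchy_def by (rule allE[of _ 1]) simp
  then obtain N where N: "\<And>m n. m \<ge> N \<Longrightarrow> n \<ge> N \<Longrightarrow> padic_abs p (s m - s n) < 1"
    by blast
  define B where "B = Max (insert 0 ((\<lambda>n. padic_abs p (s n)) ` {..N})) + 1"
  have le: "padic_abs p (s n) \<le> B - 1" if "n \<le> N" for n
  proof -
    have "padic_abs p (s n) \<le> Max (insert 0 ((\<lambda>n. padic_abs p (s n)) ` {..N}))"
      using that by (intro Max_ge) auto
    thus ?thesis by (simp add: B_def)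
  qed
  show thesis
  proof
    show "B > 0"
      using Max_ge[of "insert 0 ((\<lambda>n. padic_abs p (s n)) ` {..N})" 0] unfolding B_def by force
    show "padic_abs p (s n) \<le> B" for n
    proof (cases "n \<le> N")
      case False
      thus ?thesis
        using padic_abs_triangle[of "s n - s N" "s N"] le[of N] N[of n N] by simp
    qed (use le[of n] in auto)
  qed
qed

lemma padic_Cauchy_const: "padic_Cauchy p (\<lambda>n. c)"
  by (auto simp: padic_Cauchy_def)

lemma padic_Cauchy_add:
  assumes "padic_Cauchy p s" "padic_Cauchy p t"
  shows "padic_Cauchy p (\<lambda>n. s n + t n)"
  unfolding padic_Cauchy_def
proof (intro allI impI)
  fix e :: real assume "e > 0"
  hence e2: "e / 2 > 0" by simp
  obtain N M where N: "\<And>m n. m \<ge> N \<Longrightarrow> n \<ge> N \<Longrightarrow> padic_abs p (s m - s n) < e / 2"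
    and M: "\<And>m n. m \<ge> M \<Longrightarrow> n \<ge> M \<Longrightarrow> padic_abs p (t m - t n) < e / 2"
    using assms e2 unfolding padic_Cauchy_def by meson
  show "\<exists>N. \<forall>m\<ge>N. \<forall>n\<ge>N. padic_abs p (s m + t m - (s n + t n)) < e"
  proof (intro exI allI impI)
    fix m n assume mn: "m \<ge> max N M" "n \<ge> max N M"
    have "padic_abs p (s m + t m - (s n + t n)) = padic_abs p ((s m - s n) + (t m - t n))"
      by (simp add: algebra_simps)
    also have "\<dots> \<le> padic_abs p (s m - s n) + padic_abs p (t m - t n)"
      by (rule padic_abs_triangle)
    also have "\<dots> < e" using N[of m n] M[of m n] mn by simp
    finally show "padic_abs p (s m + t m - (s n + t n)) < e" .
  qed
qed

lemma padic_Cauchy_mult: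
  assumes "padic_Cauchy p s" "padic_Cauchy p t"
  shows "padic_Cauchy p (\<lambda>n. s n * t n)"
  unfolding padic_Cauchy_def
proof (intro allI impI)
  fix e :: real assume e: "e > 0"
  obtain B where B: "B > 0" "\<And>n. padic_abs p (s n) \<le> B" using padic_Cauchy_bounded assms(1) by blast
  obtain C where C: "C > 0" "\<And>n. padic_abs p (t n) \<le> C" using padic_Cauchy_bounded assms(2) by blast
  have eB: "e / (2 * B) > 0" and eC: "e / (2 * C) > 0" using e B C by auto
  obtain N M where N: "\<And>m n. m \<ge> N \<Longrightarrow> n \<ge> N \<Longrightarrow> padic_abs p (s m - s n) < e / (2 * C)"
    and M: "\<And>m n. m \<ge> M \<Longrightarrow> n \<ge> M \<Longrightarrow> padic_abs p (t m - t n) < e / (2 * B)"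
    using assms eB eC unfolding padic_Cauchy_def by meson
  show "\<exists>N. \<forall>m\<ge>N. \<forall>n\<ge>N. padic_abs p (s m * t m - s n * t n) < e"
  proof (intro exI allI impI)
    fix m n assume mn: "m \<ge> max N M" "n \<ge> max N M"
    have "padic_abs p (s m * t m - s n * t n) = padic_abs p (s m * (t m - t n) + (s m - s n) * t n)"
      by (simp add: algebra_simps)
    also have "\<dots> \<le> padic_abs p (s m) * padic_abs p (t m - t n) + padic_abs p (s m - s n) * padic_abs p (t n)"
      using padic_abs_triangle padic_abs_mult by metis
    also have "\<dots> \<le> B * padic_abs p (t m - t n) + padic_abs p (s m - s n) * C"
      using B C by (intro add_mono mult_mono) auto
    also have "\<dots> < B * (e / (2 * B)) + (e / (2 * C)) * C"
      using N[of m n] M[of m n] mn B C by (intro add_strict_mono mult_strict_left_mono mult_strict_right_mono) auto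
    also have "\<dots> = e" using B C by simp
    finally show "padic_abs p (s m * t m - s n * t n) < e" .
  qed
qed

lemma padic_Cauchy_uminus: "padic_Cauchy p s \<Longrightarrow> padic_Cauchy p (\<lambda>n. - s n)"
  using padic_Cauchy_mult[OF padic_Cauchy_const[of "-1"], of s] by simp

lemma padic_nullD: "s \<in> padic_null p \<Longrightarrow> e > 0 \<Longrightarrow> \<exists>N. \<forall>n\<ge>N. padic_abs p (s n) < e"
  unfolding padic_null_def LIMSEQ_iff by simp

lemma padic_null_iff: "s \<in> padic_null p \<longleftrightarrow> (\<forall>e>0. \<exists>N. \<forall>n\<ge>N. padic_abs p (s n) < e)"
  unfolding padic_null_def LIMSEQ_iff by simp

lemma padic_null_Cauchy: assumes "s \<in> padic_null p" shows "padic_Cauchy p s"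
  unfolding padic_Cauchy_def
proof (intro allI impI)
  fix e :: real assume "e > 0"
  then obtain N where N: "\<And>n. n \<ge> N \<Longrightarrow> padic_abs p (s n) < e / 2"
    using padic_nullD[OF assms, of "e / 2"] by auto
  show "\<exists>N. \<forall>m\<ge>N. \<forall>n\<ge>N. padic_abs p (s m - s n) < e"
  proof (intro exI allI impI)
    fix m n assume "m \<ge> N" "n \<ge> N"
    thus "padic_abs p (s m - s n) < e"
      using N[of m] N[of n] padic_abs_triangle_minus[of "s m" "s n"] by simp
  qed
qed

lemma padic_null_add:
  assumes "s \<in> padic_null p" "t \<in> padic_null p"
  shows "(\<lambda>n. s n + t n) \<in> padic_null p"
proof -
  have "(\<lambda>n. padic_abs p (s n) + padic_abs p (t n)) \<longlonglongrightarrow> 0"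
    using tendsto_add[of _ 0 _ _ 0] assms unfolding padic_null_def by force
  thus ?thesis unfolding padic_null_def mem_Collect_eq
    by (rule tendsto_sandwich[OF _ _ tendsto_const, rotated 2]) (auto intro!: always_eventually padic_abs_triangle)
qed

lemma padic_null_mult:
  assumes "padic_Cauchy p s" "t \<in> padic_null p"
  shows "(\<lambda>n. s n * t n) \<in> padic_null p"
proof -
  obtain B where B: "B > 0" "\<And>n. padic_abs p (s n) \<le> B" using padic_Cauchy_bounded assms(1) by blast
  have "(\<lambda>n. B * padic_abs p (t n)) \<longlonglongrightarrow> 0"
    using tendsto_mult_left[of _ 0 _ B] assms unfolding padic_null_def by force
  thus ?thesis unfolding padic_null_def mem_Collect_eq
    by (rule tendsto_sandwich[OF _ _ tendsto_const, rotated 2])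
       (auto intro!: always_eventually mult_right_mono B simp: padic_abs_mult)
qed

lemma padic_Cauchy_not_null:
  assumes "padic_Cauchy p s" "s \<notin> padic_null p"
  obtains d N where "d > 0" "\<And>n. n \<ge> N \<Longrightarrow> padic_abs p (s n) \<ge> d"
proof -
  obtain e where e: "e > 0" "\<And>N. \<exists>n\<ge>N. padic_abs p (s n) \<ge> e"
    using assms(2) unfolding padic_null_iff by (auto simp: not_less)
  obtain N where N: "\<And>m n. m \<ge> N \<Longrightarrow> n \<ge> N \<Longrightarrow> padic_abs p (s m - s n) < e / 2"
    using assms(1) e(1) unfolding padic_Cauchy_def by (meson half_gt_zero)
  obtain m where m: "m \<ge> N" "padic_abs p (s m) \<ge> e" using e(2) by blast
  show thesis
  proof
    show "e / 2 > 0" using e by simp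
    show "padic_abs p (s n) \<ge> e / 2" if "n \<ge> N" for n
      using padic_abs_triangle[of "s m - s n" "s n"] N[of m n] m that by simp
  qed
qed

lemma padic_Cauchy_inverse:
  assumes "padic_Cauchy p s" "s \<notin> padic_null p"
  shows "padic_Cauchy p (\<lambda>n. inverse (s n))"
  unfolding padic_Cauchy_def
proof (intro allI impI)
  fix e :: real assume e: "e > 0"
  obtain d M where d: "d > 0" "\<And>n. n \<ge> M \<Longrightarrow> padic_abs p (s n) \<ge> d"
    using padic_Cauchy_not_null[OF assms] by blast
  have "e * (d * d) > 0" using e d by simp
  then obtain N where N: "\<And>m n. m \<ge> N \<Longrightarrow> n \<ge> N \<Longrightarrow> padic_abs p (s m - s n) < e * (d * d)"
    using assms(1) unfolding padic_Cauchy_def by meson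
  show "\<exists>N. \<forall>m\<ge>N. \<forall>n\<ge>N. padic_abs p (inverse (s m) - inverse (s n)) < e"
  proof (intro exI allI impI)
    fix m n assume mn: "m \<ge> max N M" "n \<ge> max N M"
    let ?x = "inverse (s m) - inverse (s n)"
    have dd: "padic_abs p (s m) \<ge> d" "padic_abs p (s n) \<ge> d" using d mn by auto
    have nz: "s m \<noteq> 0" "s n \<noteq> 0" using dd d(1) by auto
    have "s n - s m = ?x * (s m * s n)" using nz by (simp add: field_simps)
    hence "padic_abs p (s n - s m) = padic_abs p ?x * (padic_abs p (s m) * padic_abs p (s n))"
      by (simp add: padic_abs_mult)
    moreover have "padic_abs p ?x * (d * d) \<le> padic_abs p ?x * (padic_abs p (s m) * padic_abs p (s n))"
      using dd d(1) by (intro mult_left_mono mult_mono) auto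
    moreover have "padic_abs p (s n - s m) < e * (d * d)" using N mn by auto
    ultimately have "padic_abs p ?x * (d * d) < e * (d * d)" by linarith
    thus "padic_abs p ?x < e" using d(1) by simp
  qed
qed

lemma cring_padic_Cauchy_ring: "cring (padic_Cauchy_ring p)"
proof (intro cringI abelian_groupI comm_monoidI)
  show "\<exists>y\<in>carrier (padic_Cauchy_ring p). y \<oplus>\<^bsub>padic_Cauchy_ring p\<^esub> x = \<zero>\<^bsub>padic_Cauchy_ring p\<^esub>"
    if "x \<in> carrier (padic_Cauchy_ring p)" for x
    using that padic_Cauchy_uminus[of x] by (intro bexI[of _ "\<lambda>n. - x n"]) (auto simp: padic_Cauchy_ring_def)
qed (auto simp: padic_Cauchy_ring_def padic_Cauchy_add padic_Cauchy_mult padic_Cauchy_const algebra_simps)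

lemma maximalideal_padic_null: "maximalideal (padic_null p) (padic_Cauchy_ring p)"
proof -
  let ?R = "padic_Cauchy_ring p"
  interpret cring ?R by (rule cring_padic_Cauchy_ring)
  have carr: "carrier ?R = {s. padic_Cauchy p s}" by (simp add: padic_Cauchy_ring_def)
  have ainv: "\<ominus>\<^bsub>?R\<^esub> s = (\<lambda>n. - s n)" if "s \<in> carrier ?R" for s
    using that by (intro minus_equality) (auto simp: padic_Cauchy_ring_def padic_Cauchy_uminus)
  have id: "ideal (padic_null p) ?R"
  proof (rule idealI)
    show "subgroup (padic_null p) (add_monoid ?R)"
    proof (rule group.subgroupI)
      show "group (add_monoid ?R)" by (rule add.group_axioms)
      show "padic_null p \<subseteq> carrier (add_monoid ?R)" using padic_null_Cauchy by (auto simp: carr)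
      show "padic_null p \<noteq> {}" by (auto simp: padic_null_def intro!: exI[of _ "\<lambda>n. 0"])
      show "inv\<^bsub>add_monoid ?R\<^esub> a \<in> padic_null p" if "a \<in> padic_null p" for a
        using that ainv[of a] padic_null_Cauchy[of a] padic_null_iff
        unfolding a_inv_def by (simp add: carr)
      show "a \<otimes>\<^bsub>add_monoid ?R\<^esub> b \<in> padic_null p" if "a \<in> padic_null p" "b \<in> padic_null p" for a b
        using padic_null_add that by (simp add: padic_Cauchy_ring_def)
    qed
    show "x \<otimes>\<^bsub>?R\<^esub> a \<in> padic_null p" "a \<otimes>\<^bsub>?R\<^esub> x \<in> padic_null p"
      if "a \<in> padic_null p" "x \<in> carrier ?R" for a x
      using padic_null_mult[of x a] that by (auto simp: padic_Cauchy_ring_def mult.commute)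
  qed (rule ring_axioms)
  show ?thesis
  proof (rule maximalidealI[OF id])
    have "(\<lambda>n. 1) \<notin> padic_null p" by (auto simp: padic_null_def LIMSEQ_const_iff)
    thus "carrier ?R \<noteq> padic_null p" using padic_Cauchy_const[of 1] by (auto simp: carr)
    fix J assume J: "ideal J ?R" "padic_null p \<subseteq> J" "J \<subseteq> carrier ?R"
    interpret J: ideal J ?R by fact
    show "J = padic_null p \<or> J = carrier ?R"
    proof (rule disjCI)
      assume "J \<noteq> carrier ?R"
      show "J = padic_null p"
      proof (rule ccontr)
        assume "J \<noteq> padic_null p"
        then obtain s where s: "s \<in> J" "s \<notin> padic_null p" using J by auto
        have cs: "padic_Cauchy p s" using s J by (auto simp: carr)
        define t where "t = (\<lambda>n. s n * inverse (s n))"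
        define u where "u = (\<lambda>n. 1 - t n)"
        have t: "t \<in> J"
          using J.I_r_closed[OF s(1), of "\<lambda>n. inverse (s n)"] padic_Cauchy_inverse[OF cs s(2)]
          by (simp add: padic_Cauchy_ring_def t_def)
        obtain d N where d: "d > 0" "\<And>n. n \<ge> N \<Longrightarrow> padic_abs p (s n) \<ge> d"
          using padic_Cauchy_not_null[OF cs s(2)] by blast
        have "u n = 0" if "n \<ge> N" for n
          using d(1) d(2)[OF that] by (cases "s n = 0") (auto simp: u_def t_def)
        hence "u \<in> padic_null p" unfolding padic_null_iff by (auto intro!: exI[of _ N])
        hence "t \<oplus>\<^bsub>?R\<^esub> u \<in> J" using t J by (intro J.a_closed) auto
        moreover have "t \<oplus>\<^bsub>?R\<^esub> u = \<one>\<^bsub>?R\<^esub>" by (auto simp: padic_Cauchy_ring_def u_def)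
        ultimately have "J = carrier ?R" using J.one_imp_carrier by simp
        thus False using \<open>J \<noteq> carrier ?R\<close> by simp
      qed
    qed
  qed
qed

lemma field_Qp: "field (Qp p)"
  unfolding Qp_def
  using maximalideal.quotient_is_field[OF maximalideal_padic_null cring_padic_Cauchy_ring] .

end


section \<open>Quadratic spaces\<close>

text \<open>The inherited multiplication of the underlying ring record plays no role, as for
  modules in general.\<close>

record ('a, 'b) quad = "('a, 'b) module" +
  qform :: "'b \<Rightarrow> 'a"

definition with_form :: "('a, 'b) module \<Rightarrow> ('b \<Rightarrow> 'a) \<Rightarrow> ('a, 'b) quad" where
  "with_form M q = module.extend M (quad.fields q)"

text \<open>The associated bilinear form, with the normalization \<open>B(x, x) = Q(x)\<close>; the
  characteristic of \<open>K\<close> is assumed not to be 2.\<close>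

definition bform :: "('a, 'm) ring_scheme \<Rightarrow> ('a, 'b) quad \<Rightarrow> 'b \<Rightarrow> 'b \<Rightarrow> 'a" where
  "bform K V x y =
     inv\<^bsub>K\<^esub> (\<one>\<^bsub>K\<^esub> \<oplus>\<^bsub>K\<^esub> \<one>\<^bsub>K\<^esub>) \<otimes>\<^bsub>K\<^esub>
       ((qform V (x \<oplus>\<^bsub>V\<^esub> y) \<ominus>\<^bsub>K\<^esub> qform V x) \<ominus>\<^bsub>K\<^esub> qform V y)"

text \<open>Additivity and homogeneity in the second argument follow, as \<open>bform\<close> is symmetric.\<close>

locale quadratic_space = vectorspace K V
  for K :: "('a, 'm) ring_scheme" (structure) and V :: "('a, 'b) quad" +
  assumes finite_dim: "fin_dim"
    and qform_closed: "x \<in> carrier V \<Longrightarrow> qform V x \<in> carrier K"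
    and qform_smult: "\<lbrakk>c \<in> carrier K; x \<in> carrier V\<rbrakk> \<Longrightarrow>
      qform V (c \<odot>\<^bsub>V\<^esub> x) = (c \<otimes> c) \<otimes> qform V x"
    and bform_add: "\<lbrakk>x \<in> carrier V; y \<in> carrier V; z \<in> carrier V\<rbrakk> \<Longrightarrow>
      bform K V (x \<oplus>\<^bsub>V\<^esub> y) z = bform K V x z \<oplus> bform K V y z"
    and bform_smult: "\<lbrakk>c \<in> carrier K; x \<in> carrier V; y \<in> carrier V\<rbrakk> \<Longrightarrow>
      bform K V (c \<odot>\<^bsub>V\<^esub> x) y = c \<otimes> bform K V x y"

definition radical :: "('a, 'm) ring_scheme \<Rightarrow> ('a, 'b) quad \<Rightarrow> 'b set" where
  "radical K V = {x \<in> carrier V. \<forall>y\<in>carrier V. bform K V x y = \<zero>\<^bsub>K\<^esub>}"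

definition nondegenerate :: "('a, 'm) ring_scheme \<Rightarrow> ('a, 'b) quad \<Rightarrow> bool" where
  "nondegenerate K V \<longleftrightarrow> radical K V = {\<zero>\<^bsub>V\<^esub>}"

abbreviation degenerate :: "('a, 'm) ring_scheme \<Rightarrow> ('a, 'b) quad \<Rightarrow> bool" where
  "degenerate K V \<equiv> \<not> nondegenerate K V"

definition embedded ::
  "('a, 'm) ring_scheme \<Rightarrow> ('a, 'b) quad \<Rightarrow> ('a, 'c) quad \<Rightarrow> bool" where
  "embedded K V W \<longleftrightarrow>
     (\<exists>f \<in> module_hom K V W. inj_on f (carrier V) \<and>
        (\<forall>v\<in>carrier V. qform W (f v) = qform V v))"

definition isometric ::
  "('a, 'm) ring_scheme \<Rightarrow> ('a, 'b) quad \<Rightarrow> ('a, 'c) quad \<Rightarrow> bool" where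
  "isometric K V W \<longleftrightarrow>
     (\<exists>f \<in> module_hom K V W. bij_betw f (carrier V) (carrier W) \<and>
        (\<forall>v\<in>carrier V. qform W (f v) = qform V v))"

definition diag :: "('a, 'm) ring_scheme \<Rightarrow> 'a list \<Rightarrow> ('a, nat \<Rightarrow> 'a) quad" where
  "diag K as = with_form (ring.func_space K {..<length as})
     (\<lambda>x. \<Oplus>\<^bsub>K\<^esub>i\<in>{..<length as}. as ! i \<otimes>\<^bsub>K\<^esub> (x i \<otimes>\<^bsub>K\<^esub> x i))"

definition orth_sum ::
  "('a, 'm) ring_scheme \<Rightarrow> ('a, 'b) quad \<Rightarrow> ('a, 'c) quad \<Rightarrow> ('a, 'b \<times> 'c) quad" where
  "orth_sum K V W = with_form (direct_sum V W)
     (\<lambda>v. qform V (fst v) \<oplus>\<^bsub>K\<^esub> qform W (snd v))"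

end

theory Submission
  imports Defs "HOL-Number_Theory.Euler_Criterion"
begin

text \<open>
  Since \<open>p\<close> is congruent to 1 modulo 4, the field of \<open>p\<close>-adic numbers contains a square root
  \<open>\<iota>\<close> of \<open>-1\<close>. Over any field with such an \<open>\<iota>\<close> and with \<open>2 \<noteq> 0\<close>, each null line in the radical
  costs exactly two squares. Writing \<open>N\<^sub>k\<close> for the \<open>k\<close>-dimensional zero form and \<open>E\<^sub>n\<close> for the sum of \<open>n\<close> squares,
  the space \<open>N\<^sub>k\<^sub>+\<^sub>1 \<oplus> S\<close> embeds in \<open>E\<^sub>n\<close> if and only if \<open>n \<ge> 2\<close> and
  \<open>N\<^sub>k \<oplus> S\<close> embeds in the sum of \<open>n - 2\<close> squares; induction on \<open>k\<close> gives
  \<open>embedded_Null_iff\<close>, and with it the theorem.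

  For \<open>\<longleftarrow>\<close>, two further coordinates accommodate one further null line, because
  \<open>x\<^sup>2 + (\<iota>x)\<^sup>2 = 0\<close> (lemma \<open>embedded_Null_SucI\<close>).

  For \<open>\<longrightarrow>\<close>, an embedding sends the last basis vector of the zero form to a nonzero isotropic vector
  \<open>u\<close>, and everything else into the orthogonal complement \<open>u\<^sup>\<bottom>\<close>. Modulo the line spanned by \<open>u\<close>, this
  complement is isometric to a sum of \<open>n - 2\<close> squares. The usual argument moves \<open>u\<close> to
  \<open>(1, \<iota>, 0, \<dots>, 0)\<close> by Witt's theorem; here the quotient map is written down directly
  (lemma \<open>isotropic_quotient\<close>). Two coordinates \<open>l\<close>, \<open>m\<close> and a square root \<open>j\<close> of \<open>-1\<close> can be
  chosen with \<open>u\<^sub>l + j u\<^sub>m \<noteq> 0\<close>. Subtracting from \<open>x \<in> u\<^sup>\<bottom>\<close> the multiple of \<open>u\<close> that makes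
  \<open>x\<^sub>l + j x\<^sub>m\<close> vanish does not change the value of the form, and afterwards
  \<open>x\<^sub>l\<^sup>2 + x\<^sub>m\<^sup>2 = (x\<^sub>l + j x\<^sub>m)(x\<^sub>l - j x\<^sub>m) = 0\<close>, so both coordinates may be dropped.

  The square root of \<open>-1\<close> is the limit of \<open>a ^ (p ^ n)\<close>, where \<open>a\<close> is an integer with
  \<open>a\<^sup>2\<close> congruent to \<open>-1\<close> modulo \<open>p\<close> (lemma \<open>Qp_square_root_minus_one\<close>).
\<close>

section \<open>Quadratic modules and their isometries\<close>

lemma with_form_simps [simp]:
  "carrier (with_form M q) = carrier M" "add (with_form M q) = add M"
  "zero (with_form M q) = zero M" "smult (with_form M q) = smult M"
  "qform (with_form M q) = q"
  by (simp_all add: with_form_def module.extend_def quad.fields_def)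

lemma module_with_form:
  assumes "module K M"
  shows "module K (with_form M q)"
proof -
  interpret module K M by fact
  show ?thesis
  proof (rule module_criteria)
    show "cring K" by (rule R.cring_axioms)
    show "\<forall>v\<in>carrier (with_form M q). \<exists>w\<in>carrier (with_form M q).
        v \<oplus>\<^bsub>with_form M q\<^esub> w = \<zero>\<^bsub>with_form M q\<^esub>"
      by (metis M.a_inv_closed M.r_neg with_form_simps(1-3))
  qed (simp_all add: M.a_ac smult_l_distr smult_r_distr smult_assoc1)
qed

lemma orth_sum_simps [simp]:
  "carrier (orth_sum K V W) = carrier V \<times> carrier W"
  "x \<oplus>\<^bsub>orth_sum K V W\<^esub> y = (fst x \<oplus>\<^bsub>V\<^esub> fst y, snd x \<oplus>\<^bsub>W\<^esub> snd y)"
  "\<zero>\<^bsub>orth_sum K V W\<^esub> = (\<zero>\<^bsub>V\<^esub>, \<zero>\<^bsub>W\<^esub>)"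
  "c \<odot>\<^bsub>orth_sum K V W\<^esub> x = (c \<odot>\<^bsub>V\<^esub> fst x, c \<odot>\<^bsub>W\<^esub> snd x)"
  "qform (orth_sum K V W) x = qform V (fst x) \<oplus>\<^bsub>K\<^esub> qform W (snd x)"
  by (simp_all add: orth_sum_def direct_sum_def)

lemma module_orth_sum: "module K V \<Longrightarrow> module K W \<Longrightarrow> module K (orth_sum K V W)"
  unfolding orth_sum_def by (intro module_with_form direct_sum_is_module)

lemma module_homI:
  assumes "\<And>x. x \<in> carrier V \<Longrightarrow> f x \<in> carrier W"
    and "\<And>x y. x \<in> carrier V \<Longrightarrow> y \<in> carrier V \<Longrightarrow> f (x \<oplus>\<^bsub>V\<^esub> y) = f x \<oplus>\<^bsub>W\<^esub> f y"
    and "\<And>c x. c \<in> carrier K \<Longrightarrow> x \<in> carrier V \<Longrightarrow> f (c \<odot>\<^bsub>V\<^esub> x) = c \<odot>\<^bsub>W\<^esub> f x"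
  shows "f \<in> module_hom K V W"
  using assms by (simp add: module_hom_def)

lemma module_hom_compose:
  "f \<in> module_hom K U V \<Longrightarrow> g \<in> module_hom K V W \<Longrightarrow> (\<lambda>x. g (f x)) \<in> module_hom K U W"
  by (auto simp: module_hom_def Pi_iff)

lemma module_hom_zero:
  assumes "module K V" "module K W" "f \<in> module_hom K V W"
  shows "f \<zero>\<^bsub>V\<^esub> = \<zero>\<^bsub>W\<^esub>"
proof -
  interpret V: module K V by fact
  interpret W: module K W by fact
  have "f (\<zero>\<^bsub>V\<^esub> \<oplus>\<^bsub>V\<^esub> \<zero>\<^bsub>V\<^esub>) = f \<zero>\<^bsub>V\<^esub> \<oplus>\<^bsub>W\<^esub> f \<zero>\<^bsub>V\<^esub>"
    using assms(3) by (rule module_hom_add) simp_all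
  moreover have "f \<zero>\<^bsub>V\<^esub> \<in> carrier W" using module_hom_closed[OF assms(3)] by auto
  ultimately show ?thesis by simp
qed

lemma module_hom_inj_onI:
  assumes "module K V" "module K W" "f \<in> module_hom K V W"
    and ker: "\<And>x. x \<in> carrier V \<Longrightarrow> f x = \<zero>\<^bsub>W\<^esub> \<Longrightarrow> x = \<zero>\<^bsub>V\<^esub>"
  shows "inj_on f (carrier V)"
proof (rule inj_onI)
  interpret V: module K V by fact
  interpret W: module K W by fact
  fix x y assume xy: "x \<in> carrier V" "y \<in> carrier V" and eq: "f x = f y"
  have f: "\<And>v. v \<in> carrier V \<Longrightarrow> f v \<in> carrier W"
    using module_hom_closed[OF assms(3)] by auto
  have "f (x \<ominus>\<^bsub>V\<^esub> y \<oplus>\<^bsub>V\<^esub> y) = f (x \<ominus>\<^bsub>V\<^esub> y) \<oplus>\<^bsub>W\<^esub> f y"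
    using assms(3) xy by (intro module_hom_add) simp_all
  moreover have "x \<ominus>\<^bsub>V\<^esub> y \<oplus>\<^bsub>V\<^esub> y = x"
    using xy by (simp add: V.minus_eq V.a_assoc V.l_neg)
  ultimately have "f (x \<ominus>\<^bsub>V\<^esub> y) \<oplus>\<^bsub>W\<^esub> f y = f y" using eq by simp
  hence "f (x \<ominus>\<^bsub>V\<^esub> y) = \<zero>\<^bsub>W\<^esub>"
    using f xy by (metis V.minus_closed W.l_zero W.add.right_cancel W.zero_closed)
  hence "x \<ominus>\<^bsub>V\<^esub> y = \<zero>\<^bsub>V\<^esub>" using xy by (intro ker) simp_all
  thus "x = y" using xy by simp
qed

lemma module_hom_inj_onD:
  assumes "module K V" "module K W" "inj_on f (carrier V)" "f \<in> module_hom K V W"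
    and "x \<in> carrier V" "f x = \<zero>\<^bsub>W\<^esub>"
  shows "x = \<zero>\<^bsub>V\<^esub>"
proof -
  interpret V: module K V by fact
  show ?thesis
    using module_hom_zero[OF assms(1,2,4)] assms(3,5,6)
    by (metis V.M.zero_closed inj_on_eq_iff)
qed

lemma embedded_trans:
  assumes "embedded K U V" "embedded K V W"
  shows "embedded K U W"
proof -
  obtain f where f: "f \<in> module_hom K U V" "inj_on f (carrier U)"
    "\<forall>v\<in>carrier U. qform V (f v) = qform U v" using assms(1) unfolding embedded_def by blast
  obtain g where g: "g \<in> module_hom K V W" "inj_on g (carrier V)"
    "\<forall>v\<in>carrier V. qform W (g v) = qform V v" using assms(2) unfolding embedded_def by blast
  have im: "f ` carrier U \<subseteq> carrier V" using module_hom_closed[OF f(1)] by auto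
  have "inj_on (\<lambda>x. g (f x)) (carrier U)"
    using comp_inj_on[OF f(2) inj_on_subset[OF g(2) im]] by (simp add: comp_def)
  moreover have "qform W (g (f v)) = qform U v" if "v \<in> carrier U" for v
    using f(3) g(3) im that by (simp add: image_subset_iff)
  ultimately show ?thesis
    unfolding embedded_def using module_hom_compose[OF f(1) g(1)] by blast
qed

lemma isometric_imp_embedded: "isometric K V W \<Longrightarrow> embedded K V W"
  unfolding isometric_def embedded_def by (auto dest: bij_betw_imp_inj_on)

lemma isometric_sym:
  assumes "module K V" "isometric K V W"
  shows "isometric K W V"
proof -
  interpret V: module K V by fact
  obtain f where f: "f \<in> module_hom K V W" "bij_betw f (carrier V) (carrier W)"
    "\<And>v. v \<in> carrier V \<Longrightarrow> qform W (f v) = qform V v"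
    using assms(2) unfolding isometric_def by blast
  define g where "g = inv_into (carrier V) f"
  have fg: "f (g w) = w" if "w \<in> carrier W" for w
    using f(2) that unfolding g_def by (metis bij_betw_inv_into_right)
  have gf: "g (f v) = v" if "v \<in> carrier V" for v
    using f(2) that unfolding g_def by (metis bij_betw_inv_into_left)
  have bij: "bij_betw g (carrier W) (carrier V)"
    unfolding g_def using f(2) by (rule bij_betw_inv_into)
  have g: "g w \<in> carrier V" if "w \<in> carrier W" for w
    using bij that by (rule bij_betw_apply)
  have "g \<in> module_hom K W V"
  proof (rule module_homI)
    fix x y assume "x \<in> carrier W" "y \<in> carrier W"
    thus "g (x \<oplus>\<^bsub>W\<^esub> y) = g x \<oplus>\<^bsub>V\<^esub> g y"
      using module_hom_add[OF f(1), of "g x" "g y"] gf[of "g x \<oplus>\<^bsub>V\<^esub> g y"] g fg by simp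
  next
    fix c x assume "c \<in> carrier K" "x \<in> carrier W"
    thus "g (c \<odot>\<^bsub>W\<^esub> x) = c \<odot>\<^bsub>V\<^esub> g x"
      using module_hom_smult[OF f(1), of c "g x"] gf[of "c \<odot>\<^bsub>V\<^esub> g x"] g fg by simp
  qed (rule g)
  moreover have "qform V (g w) = qform W w" if "w \<in> carrier W" for w
    using f(3)[of "g w"] g fg that by simp
  ultimately show ?thesis unfolding isometric_def using bij by blast
qed

lemma isometric_embedded_iff:
  assumes "module K V" "isometric K V W"
  shows "embedded K V U \<longleftrightarrow> embedded K W U"
  using isometric_imp_embedded[OF assms(2)] isometric_imp_embedded[OF isometric_sym[OF assms]]
    by (metis embedded_trans)

section \<open>Sums of squares over a field with a square root of -1\<close>

locale field_with_i = field K for K :: "('a, 'm) ring_scheme" (structure) +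
  fixes \<iota> :: 'a
  assumes i_closed [simp]: "\<iota> \<in> carrier K"
    and i_sq: "\<iota> \<otimes> \<iota> \<oplus> \<one> = \<zero>"
    and two_neq_zero: "\<one> \<oplus> \<one> \<noteq> \<zero>"
begin

lemma module_diag: "module K (diag K as)"
  unfolding diag_def by (intro module_with_form func_space_is_module)

lemma diag_simps [simp]:
  "carrier (diag K as) = {..<length as} \<rightarrow>\<^sub>E carrier K"
  "x \<oplus>\<^bsub>diag K as\<^esub> y = (\<lambda>i\<in>{..<length as}. x i \<oplus> y i)"
  "\<zero>\<^bsub>diag K as\<^esub> = (\<lambda>i\<in>{..<length as}. \<zero>)"
  "c \<odot>\<^bsub>diag K as\<^esub> x = (\<lambda>i\<in>{..<length as}. c \<otimes> x i)"
  by (simp_all add: diag_def func_space_def)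

abbreviation Null :: "nat \<Rightarrow> ('a, nat \<Rightarrow> 'a) quad" where
  "Null k \<equiv> diag K (replicate k \<zero>)"

abbreviation Eucl :: "nat \<Rightarrow> ('a, nat \<Rightarrow> 'a) quad" where
  "Eucl n \<equiv> diag K (replicate n \<one>)"

text \<open>The bilinear form of \<open>Eucl n\<close>, defined by its sum rather than as the instance of \<open>bform\<close>:
  the sum makes sense for functions that are not extensional, so that the vectors in computations
  can be plain \<open>\<lambda>\<close>-terms.\<close>

definition dot :: "nat \<Rightarrow> (nat \<Rightarrow> 'a) \<Rightarrow> (nat \<Rightarrow> 'a) \<Rightarrow> 'a" where
  "dot n x y = (\<Oplus>i\<in>{..<n}. x i \<otimes> y i)"

lemma qform_Null [simp]: "x \<in> carrier (Null k) \<Longrightarrow> qform (Null k) x = \<zero>"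
  by (auto simp: diag_def func_space_def PiE_iff intro!: add.finprod_one_eqI)

lemma qform_Eucl: "x \<in> carrier (Eucl n) \<Longrightarrow> qform (Eucl n) x = dot n x x"
  by (auto simp: diag_def func_space_def dot_def PiE_iff intro!: finsum_cong')

lemma dot_closed [simp]:
  "x \<in> {..<n} \<rightarrow> carrier K \<Longrightarrow> y \<in> {..<n} \<rightarrow> carrier K \<Longrightarrow> dot n x y \<in> carrier K"
  by (auto simp: dot_def Pi_iff intro!: finsum_closed)

lemma dot_add_smult:
  assumes "x \<in> {..<n} \<rightarrow> carrier K" "y \<in> {..<n} \<rightarrow> carrier K" "z \<in> {..<n} \<rightarrow> carrier K"
    "c \<in> carrier K"
  shows "dot n (\<lambda>i. x i \<oplus> c \<otimes> y i) z = dot n x z \<oplus> c \<otimes> dot n y z"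
proof -
  have "dot n (\<lambda>i. x i \<oplus> c \<otimes> y i) z = (\<Oplus>i\<in>{..<n}. x i \<otimes> z i \<oplus> c \<otimes> (y i \<otimes> z i))"
    unfolding dot_def using assms by (intro finsum_cong') (auto simp: Pi_iff l_distr m_assoc)
  also have "\<dots> = dot n x z \<oplus> (\<Oplus>i\<in>{..<n}. c \<otimes> (y i \<otimes> z i))"
    unfolding dot_def using assms by (intro finsum_addf) (auto simp: Pi_iff)
  also have "(\<Oplus>i\<in>{..<n}. c \<otimes> (y i \<otimes> z i)) = c \<otimes> dot n y z"
    unfolding dot_def using assms by (intro finsum_rdistr[symmetric]) (auto simp: Pi_iff)
  finally show ?thesis .
qed

lemma dot_commute:
  "x \<in> {..<n} \<rightarrow> carrier K \<Longrightarrow> y \<in> {..<n} \<rightarrow> carrier K \<Longrightarrow> dot n x y = dot n y x"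
  unfolding dot_def by (intro finsum_cong') (auto simp: Pi_iff m_comm)

lemma dot_self_add_smult:
  assumes "x \<in> {..<n} \<rightarrow> carrier K" "y \<in> {..<n} \<rightarrow> carrier K" "c \<in> carrier K"
  shows "dot n (\<lambda>i. x i \<oplus> c \<otimes> y i) (\<lambda>i. x i \<oplus> c \<otimes> y i) =
    dot n x x \<oplus> ((\<one> \<oplus> \<one>) \<otimes> c \<otimes> dot n x y \<oplus> c \<otimes> c \<otimes> dot n y y)"
proof -
  let ?z = "\<lambda>i. x i \<oplus> c \<otimes> y i"
  have z: "?z \<in> {..<n} \<rightarrow> carrier K" using assms by (auto simp: Pi_iff)
  have "dot n ?z ?z = dot n ?z x \<oplus> c \<otimes> dot n ?z y"
    using assms z by (simp add: dot_add_smult[of x n y ?z c] dot_commute[of _ n ?z])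
  also have "\<dots> = dot n x x \<oplus> c \<otimes> dot n x y \<oplus> c \<otimes> (dot n x y \<oplus> c \<otimes> dot n y y)"
    using assms by (simp add: dot_add_smult dot_commute[of y n x])
  also have "\<dots> = dot n x x \<oplus> ((\<one> \<oplus> \<one>) \<otimes> c \<otimes> dot n x y \<oplus> c \<otimes> c \<otimes> dot n y y)"
    using assms by (simp add: l_distr r_distr m_assoc a_assoc)
  finally show ?thesis .
qed

lemma field_with_minus_i: "field_with_i K (\<ominus> \<iota>)"
  by unfold_locales (use i_sq two_neq_zero in \<open>simp_all add: l_minus r_minus\<close>)


lemma dot_cong:
  assumes "\<And>i. i < n \<Longrightarrow> x i = x' i" "\<And>i. i < n \<Longrightarrow> y i = y' i"
    "x' \<in> {..<n} \<rightarrow> carrier K" "y' \<in> {..<n} \<rightarrow> carrier K"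
  shows "dot n x y = dot n x' y'"
  unfolding dot_def using assms by (intro finsum_cong') (auto simp: Pi_iff)

lemma dot_Suc:
  assumes "x \<in> {..<Suc n} \<rightarrow> carrier K" "y \<in> {..<Suc n} \<rightarrow> carrier K"
  shows "dot (Suc n) x y = x n \<otimes> y n \<oplus> dot n x y"
  unfolding dot_def lessThan_Suc using assms by (intro finsum_insert) (auto simp: Pi_iff)

text \<open>The coordinates \<open>l\<close> and \<open>m\<close> are separated from the others, which \<open>\<beta>\<close> renumbers.\<close>

lemma dot_split:
  assumes "l < n" "m < n" "l \<noteq> m" and \<beta>: "bij_betw \<beta> {..<n - 2} ({..<n} - {l, m})"
    and x: "x \<in> {..<n} \<rightarrow> carrier K" and y: "y \<in> {..<n} \<rightarrow> carrier K"
  shows "dot n x y = x l \<otimes> y l \<oplus> (x m \<otimes> y m \<oplus> dot (n - 2) (\<lambda>i. x (\<beta> i)) (\<lambda>i. y (\<beta> i)))"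
proof -
  let ?g = "\<lambda>i. x i \<otimes> y i"
  have *: "{..<n} = insert l (insert m (\<beta> ` {..<n - 2}))"
    using assms(1-3) bij_betw_imp_surj_on[OF \<beta>] by auto
  have g: "?g i \<in> carrier K" if "i < n" for i using x y that by (auto simp: Pi_iff)
  have im: "\<beta> ` {..<n - 2} = {..<n} - {l, m}" using \<beta> by (rule bij_betw_imp_surj_on)
  have "dot n x y = ?g l \<oplus> (?g m \<oplus> (\<Oplus>i\<in>\<beta> ` {..<n - 2}. ?g i))"
    unfolding dot_def * using assms(1-3) g im
    by (subst finsum_insert, auto)+
  also have "(\<Oplus>i\<in>\<beta> ` {..<n - 2}. ?g i) = (\<Oplus>i\<in>{..<n - 2}. ?g (\<beta> i))"
    using im g bij_betw_imp_inj_on[OF \<beta>] by (intro finsum_reindex) auto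
  finally show ?thesis unfolding dot_def .
qed

text \<open>Adding the expressions for \<open>j = \<iota>\<close> and \<open>j = -\<iota>\<close> gives \<open>2a \<noteq> 0\<close>, so one of the two roots
  works.\<close>

lemma square_root_with_nonzero_combination:
  assumes "a \<in> carrier K" "b \<in> carrier K" "a \<noteq> \<zero>"
  obtains j where "j \<in> carrier K" "j \<otimes> j \<oplus> \<one> = \<zero>" "a \<oplus> j \<otimes> b \<noteq> \<zero>"
proof (cases "a \<oplus> \<iota> \<otimes> b = \<zero>")
  case False
  thus thesis by (rule that[OF i_closed i_sq])
next
  case True
  have "a \<oplus> \<ominus> \<iota> \<otimes> b \<noteq> \<zero>"
  proof
    assume "a \<oplus> \<ominus> \<iota> \<otimes> b = \<zero>"
    moreover have "(\<one> \<oplus> \<one>) \<otimes> a = (a \<oplus> \<iota> \<otimes> b) \<oplus> (a \<oplus> \<ominus> \<iota> \<otimes> b)"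
      using assms i_closed by algebra
    ultimately have "(\<one> \<oplus> \<one>) \<otimes> a = \<zero>" using True by simp
    thus False using assms two_neq_zero by (simp add: integral_iff)
  qed
  thus thesis using field_with_i.i_sq[OF field_with_minus_i] by (intro that) simp_all
qed

section \<open>The orthogonal complement of an isotropic vector\<close>

text \<open>The quotient of \<open>u\<^sup>\<bottom>\<close> by the line of \<open>u\<close> is a sum of \<open>n - 2\<close> squares. The map \<open>\<phi>\<close> given
  by the proof is linear on the whole space, so that \<open>u\<^sup>\<bottom>\<close> need not be set up as a quadratic
  space of its own; only its values on \<open>u\<^sup>\<bottom>\<close> matter. The bound \<open>2 \<le> n\<close> comes out along the way,
  since one nonzero square is never isotropic.\<close>

lemma isotropic_quotient:
  assumes u: "u \<in> carrier (Eucl n)" "u \<noteq> \<zero>\<^bsub>Eucl n\<^esub>" and iso: "dot n u u = \<zero>"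
  obtains \<phi> where "2 \<le> n" "\<phi> \<in> module_hom K (Eucl n) (Eucl (n - 2))"
    "\<And>x. x \<in> carrier (Eucl n) \<Longrightarrow> dot n x u = \<zero> \<Longrightarrow> qform (Eucl (n - 2)) (\<phi> x) = dot n x x"
    "\<And>x. x \<in> carrier (Eucl n) \<Longrightarrow> dot n x u = \<zero> \<Longrightarrow> \<phi> x = \<zero>\<^bsub>Eucl (n - 2)\<^esub> \<Longrightarrow>
       \<exists>c\<in>carrier K. x = c \<odot>\<^bsub>Eucl n\<^esub> u"
proof -
  have uc: "u i \<in> carrier K" if "i < n" for i using u(1) that by (auto simp: PiE_iff)
  have "\<exists>l<n. u l \<noteq> \<zero>"
  proof (rule ccontr)
    assume "\<not> (\<exists>l<n. u l \<noteq> \<zero>)"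
    hence "u = \<zero>\<^bsub>Eucl n\<^esub>" using u(1) by (auto simp: PiE_iff extensional_def fun_eq_iff)
    thus False using u(2) by simp
  qed
  then obtain l where l: "l < n" "u l \<noteq> \<zero>" by blast
  have "\<exists>m<n. m \<noteq> l"
  proof (rule ccontr)
    assume "\<not> (\<exists>m<n. m \<noteq> l)"
    hence *: "{..<n} = {l}" using l(1) by blast
    have "dot n u u = u l \<otimes> u l" unfolding dot_def * using uc[OF l(1)] by simp
    thus False using iso l(2) integral[of "u l" "u l"] uc[OF l(1)] by simp
  qed
  then obtain m where m: "m < n" "m \<noteq> l" by blast
  obtain j where j: "j \<in> carrier K" "j \<otimes> j \<oplus> \<one> = \<zero>" "u l \<oplus> j \<otimes> u m \<noteq> \<zero>"
    using square_root_with_nonzero_combination[OF uc[OF l(1)] uc[OF m(1)] l(2)] .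
  define w where "w = u l \<oplus> j \<otimes> u m"
  have w: "w \<in> carrier K" "w \<noteq> \<zero>" using j l m uc by (auto simp: w_def)
  hence wi: "inv w \<in> carrier K" "inv w \<otimes> w = \<one>"
    using field_Units by auto
  have n2: "2 \<le> n" using l m by linarith
  have "card ({..<n} - {l, m}) = n - 2" using l m by (simp add: card_Diff_subset)
  then obtain \<beta> where \<beta>: "bij_betw \<beta> {..<n - 2} ({..<n} - {l, m})"
    using ex_bij_betw_nat_finite[of "{..<n} - {l, m}"] by (auto simp: atLeast0LessThan)
  have \<beta>n: "\<beta> i < n" if "i < n - 2" for i using bij_betw_apply[OF \<beta>] that by auto
  \<comment> \<open>\<open>r x\<close> is the representative of \<open>x\<close> modulo \<open>u\<close> on which the functional \<open>x\<^sub>l + j x\<^sub>m\<close> vanishes.\<close>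
  define c where "c = (\<lambda>x. (x l \<oplus> j \<otimes> x m) \<otimes> inv w)"
  define r where "r = (\<lambda>x i. x i \<oplus> (\<ominus> c x) \<otimes> u i)"
  define \<phi> where "\<phi> = (\<lambda>x. \<lambda>i\<in>{..<n - 2}. r x (\<beta> i))"
  have cc: "c x \<in> carrier K" if "x \<in> carrier (Eucl n)" for x
    using that l m j wi by (auto simp: c_def PiE_iff)
  have rc: "r x i \<in> carrier K" if "x \<in> carrier (Eucl n)" "i < n" for x i
    using that cc[OF that(1)] uc by (auto simp: r_def PiE_iff)
  have rlm: "r x l \<oplus> j \<otimes> r x m = \<zero>" if x: "x \<in> carrier (Eucl n)" for x
  proof -
    have xc: "x l \<in> carrier K" "x m \<in> carrier K" using x l m by (auto simp: PiE_iff)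
    have "r x l \<oplus> j \<otimes> r x m = (x l \<oplus> j \<otimes> x m) \<oplus> \<ominus> (c x \<otimes> w)"
      unfolding r_def w_def using cc[OF x] xc j(1) uc[OF l(1)] uc[OF m(1)] by algebra
    also have "c x \<otimes> w = x l \<oplus> j \<otimes> x m"
      using xc j w wi by (simp add: c_def m_assoc)
    finally show ?thesis using xc j by (simp add: r_neg)
  qed
  have rl: "r x l = \<ominus> (j \<otimes> r x m)" if x: "x \<in> carrier (Eucl n)" for x
    using rlm[OF x] rc[OF x] l m j by (metis m_closed minus_equality)
  show thesis
  proof
    show "2 \<le> n" by (rule n2)
    show "\<phi> \<in> module_hom K (Eucl n) (Eucl (n - 2))"
    proof (rule module_homI)
      fix x assume "x \<in> carrier (Eucl n)"
      thus "\<phi> x \<in> carrier (Eucl (n - 2))" using rc \<beta>n by (auto simp: \<phi>_def)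
    next
      fix x y assume x: "x \<in> carrier (Eucl n)" and y: "y \<in> carrier (Eucl n)"
      have xc: "x i \<in> carrier K" "y i \<in> carrier K" if "i < n" for i
        using x y that by (auto simp: PiE_iff)
      let ?z = "x \<oplus>\<^bsub>Eucl n\<^esub> y"
      have c: "c ?z = c x \<oplus> c y"
        unfolding c_def using l m j(1) wi(1) xc[OF l(1)] xc[OF m(1)]
        by (simp add: l_distr r_distr a_ac)
      have "r ?z i = r x i \<oplus> r y i" if i: "i < n" for i
        unfolding r_def c using xc[OF i] uc[OF i] cc[OF x] cc[OF y] i
        by (simp add: l_distr minus_add l_minus a_ac)
      thus "\<phi> ?z = \<phi> x \<oplus>\<^bsub>Eucl (n - 2)\<^esub> \<phi> y"
        using \<beta>n by (auto simp: \<phi>_def fun_eq_iff)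
    next
      fix a x assume a: "a \<in> carrier K" and x: "x \<in> carrier (Eucl n)"
      have xc: "x i \<in> carrier K" if "i < n" for i using x that by (auto simp: PiE_iff)
      let ?z = "a \<odot>\<^bsub>Eucl n\<^esub> x"
      have c: "c ?z = a \<otimes> c x"
        unfolding c_def using l m j(1) wi(1) xc[OF l(1)] xc[OF m(1)] a
        by (simp add: l_distr r_distr m_ac)
      have "r ?z i = a \<otimes> r x i" if i: "i < n" for i
        unfolding r_def c using xc[OF i] uc[OF i] cc[OF x] a i
        by (simp add: r_distr l_minus r_minus m_ac)
      thus "\<phi> ?z = a \<odot>\<^bsub>Eucl (n - 2)\<^esub> \<phi> x"
        using \<beta>n by (auto simp: \<phi>_def fun_eq_iff)
    qed
  next
    fix x assume x: "x \<in> carrier (Eucl n)" and xu: "dot n x u = \<zero>"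
    have r: "r x \<in> {..<n} \<rightarrow> carrier K" using rc[OF x] by auto
    have rm: "r x m \<in> carrier K" using rc[OF x m(1)] .
    have xf: "x \<in> {..<n} \<rightarrow> carrier K" and uf: "u \<in> {..<n} \<rightarrow> carrier K"
      using x u by auto
    have \<phi>x: "\<phi> x \<in> carrier (Eucl (n - 2))" using rc[OF x] \<beta>n by (auto simp: \<phi>_def)
    have "qform (Eucl (n - 2)) (\<phi> x) = dot (n - 2) (\<lambda>i. r x (\<beta> i)) (\<lambda>i. r x (\<beta> i))"
      unfolding qform_Eucl[OF \<phi>x] using rc[OF x] \<beta>n by (intro dot_cong) (auto simp: \<phi>_def)
    also have "\<dots> = r x l \<otimes> r x l \<oplus>
        (r x m \<otimes> r x m \<oplus> dot (n - 2) (\<lambda>i. r x (\<beta> i)) (\<lambda>i. r x (\<beta> i)))"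
    proof -
      have "r x l \<otimes> r x l \<oplus> r x m \<otimes> r x m = (j \<otimes> j \<oplus> \<one>) \<otimes> (r x m \<otimes> r x m)"
        unfolding rl[OF x] using rm j(1) by algebra
      also have "\<dots> = \<zero>" using j rm by simp
      finally have "r x l \<otimes> r x l \<oplus> r x m \<otimes> r x m = \<zero>" .
      moreover have "dot (n - 2) (\<lambda>i. r x (\<beta> i)) (\<lambda>i. r x (\<beta> i)) \<in> carrier K"
        using rc[OF x] \<beta>n by (intro dot_closed) auto
      ultimately show ?thesis using rm rc[OF x l(1)] by (simp flip: a_assoc)
    qed
    also have "\<dots> = dot n (r x) (r x)"
      using l m \<beta> r by (intro dot_split[symmetric]) auto
    also have "\<dots> = dot n x x"
      unfolding r_def using xf uf cc[OF x] xu iso by (simp add: dot_self_add_smult)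
    finally show "qform (Eucl (n - 2)) (\<phi> x) = dot n x x" .
  next
    fix x assume x: "x \<in> carrier (Eucl n)" and xu: "dot n x u = \<zero>"
      and \<phi>0: "\<phi> x = \<zero>\<^bsub>Eucl (n - 2)\<^esub>"
    have r: "r x \<in> {..<n} \<rightarrow> carrier K" using rc[OF x] by auto
    have rm: "r x m \<in> carrier K" using rc[OF x m(1)] .
    have xf: "x \<in> {..<n} \<rightarrow> carrier K" and uf: "u \<in> {..<n} \<rightarrow> carrier K"
      using x u by auto
    have r\<beta>: "r x (\<beta> i) = \<zero>" if "i < n - 2" for i
      using fun_cong[OF \<phi>0, of i] that by (simp add: \<phi>_def)
    \<comment> \<open>Only the coordinates \<open>l\<close> and \<open>m\<close> of \<open>r x\<close> can be nonzero, so \<open>r x\<close> is a multiple of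
      \<open>(-j, 1)\<close> there. Its product with \<open>u\<close> is the nonzero factor \<open>-j w\<close> times \<open>r x m\<close>, and
      orthogonality to \<open>u\<close> forces \<open>r x\<close> to vanish.\<close>
    have "dot n (r x) u = \<zero>"
      unfolding r_def using xf uf cc[OF x] xu iso by (simp add: dot_add_smult)
    also have "dot n (r x) u = r x l \<otimes> u l \<oplus>
        (r x m \<otimes> u m \<oplus> dot (n - 2) (\<lambda>i. r x (\<beta> i)) (\<lambda>i. u (\<beta> i)))"
      using l m \<beta> r uf by (intro dot_split) auto
    also have "dot (n - 2) (\<lambda>i. r x (\<beta> i)) (\<lambda>i. u (\<beta> i)) = \<zero>"
      unfolding dot_def using r\<beta> \<beta>n uc by (intro add.finprod_one_eqI) auto
    finally have "r x l \<otimes> u l \<oplus> r x m \<otimes> u m = \<zero>"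
      using rm rc[OF x l(1)] uc l m by simp
    moreover have "r x l \<otimes> u l \<oplus> r x m \<otimes> u m =
        \<ominus> (j \<otimes> r x m \<otimes> (u l \<oplus> j \<otimes> u m)) \<oplus> (j \<otimes> j \<oplus> \<one>) \<otimes> (r x m \<otimes> u m)"
      unfolding rl[OF x] using rm j(1) uc[OF l(1)] uc[OF m(1)] by algebra
    ultimately have "j \<otimes> r x m \<otimes> w = \<zero>"
      using j(1,2) rm uc[OF l(1)] uc[OF m(1)] by (simp add: w_def)
    moreover have "j \<noteq> \<zero>" using j(2) by auto
    ultimately have rm0: "r x m = \<zero>" using j(1) rm w by (simp add: integral_iff)
    hence rl0: "r x l = \<zero>" using rl[OF x] j(1) by simp
    have "x i = c x \<otimes> u i" if i: "i < n" for i
    proof -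
      have "r x i = \<zero>"
      proof (cases "i = l \<or> i = m")
        case False
        hence "i \<in> \<beta> ` {..<n - 2}" using i bij_betw_imp_surj_on[OF \<beta>] by auto
        thus ?thesis using r\<beta> by auto
      qed (use rl0 rm0 in auto)
      moreover have "x i = r x i \<oplus> c x \<otimes> u i"
        unfolding r_def using x i cc[OF x] uc[OF i]
        by (simp add: PiE_iff a_assoc l_minus l_neg)
      ultimately show ?thesis using cc[OF x] uc[OF i] by simp
    qed
    hence "x = c x \<odot>\<^bsub>Eucl n\<^esub> u"
      using x by (auto simp: PiE_iff extensional_def fun_eq_iff)
    thus "\<exists>c\<in>carrier K. x = c \<odot>\<^bsub>Eucl n\<^esub> u" using cc[OF x] by blast
  qed
qed

section \<open>Trading a null line for two squares\<close>

lemma qform_orth_sum_Null: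
  assumes "quadratic_space K S" "v \<in> carrier (orth_sum K (Null k) S)"
  shows "qform (orth_sum K (Null k) S) v = qform S (snd v)"
proof -
  interpret S: quadratic_space K S by fact
  have "fst v \<in> carrier (Null k)" "snd v \<in> carrier S"
    using assms(2) by (simp_all only: orth_sum_simps(1) mem_Times_iff)
  thus ?thesis unfolding orth_sum_simps(5) qform_Null[OF \<open>fst v \<in> carrier (Null k)\<close>]
    using S.qform_closed by simp
qed

text \<open>The new embedding is the old one, restricted to the complement of the null vector \<open>e\<close> and
  followed by the quotient map modulo its image \<open>u\<close>. Injectivity survives because the preimage
  of the line of \<open>u\<close> is the line of \<open>e\<close>, which meets that complement in \<open>0\<close>.\<close>

lemma embedded_Null_Suc_imp:
  assumes S: "quadratic_space K S"
    and emb: "embedded K (orth_sum K (Null (Suc k)) S) (Eucl n)"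
  shows "2 \<le> n \<and> embedded K (orth_sum K (Null k) S) (Eucl (n - 2))"
proof -
  interpret S: quadratic_space K S by fact
  let ?V = "orth_sum K (Null (Suc k)) S" and ?W = "orth_sum K (Null k) S"
  have V: "module K ?V" and W: "module K ?W"
    by (intro module_orth_sum module_diag S.module_axioms)+
  interpret V: module K ?V by (rule V)
  obtain f where f: "f \<in> module_hom K ?V (Eucl n)" "inj_on f (carrier ?V)"
    and Qf: "\<And>v. v \<in> carrier ?V \<Longrightarrow> qform (Eucl n) (f v) = qform ?V v"
    using emb unfolding embedded_def by blast
  have fc: "f v \<in> carrier (Eucl n)" if "v \<in> carrier ?V" for v
    using module_hom_closed[OF f(1)] that by auto
  have ffun: "f v \<in> {..<n} \<rightarrow> carrier K" if "v \<in> carrier ?V" for v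
    using fc[OF that] by auto
  define e where "e = (\<lambda>i\<in>{..<Suc k}. if i = k then \<one> else \<zero>, \<zero>\<^bsub>S\<^esub>)"
  have e: "e \<in> carrier ?V" by (auto simp: e_def)
  define h where "h = (\<lambda>(x, s::'b). (\<lambda>i\<in>{..<Suc k}. if i = k then \<zero> else x i, s))"
  have h: "h \<in> module_hom K ?W ?V"
  proof (rule module_homI)
    fix v assume "v \<in> carrier ?W"
    thus "h v \<in> carrier ?V"
      by (cases v) (simp add: h_def PiE_iff Ball_def less_Suc_eq)
  next
    fix v w assume "v \<in> carrier ?W" "w \<in> carrier ?W"
    thus "h (v \<oplus>\<^bsub>?W\<^esub> w) = h v \<oplus>\<^bsub>?V\<^esub> h w"
      by (cases v; cases w) (simp add: h_def restrict_def fun_eq_iff)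
  next
    fix c v assume "c \<in> carrier K" "v \<in> carrier ?W"
    thus "h (c \<odot>\<^bsub>?W\<^esub> v) = c \<odot>\<^bsub>?V\<^esub> h v"
      by (cases v) (simp add: h_def restrict_def fun_eq_iff)
  qed
  have hc: "h w \<in> carrier ?V" if "w \<in> carrier ?W" for w
    using module_hom_closed[OF h] that by auto
  have Qh: "qform ?V (h w) = qform ?W w" if "w \<in> carrier ?W" for w
    unfolding qform_orth_sum_Null[OF S hc[OF that]] qform_orth_sum_Null[OF S that]
    by (simp add: h_def split: prod.splits)
  have Q0: "qform S \<zero>\<^bsub>S\<^esub> = \<zero>"
    using S.qform_smult[of \<zero> "\<zero>\<^bsub>S\<^esub>"] S.qform_closed by simp
  have fe_nz: "f e \<noteq> \<zero>\<^bsub>Eucl n\<^esub>"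
  proof
    assume "f e = \<zero>\<^bsub>Eucl n\<^esub>"
    hence "e = \<zero>\<^bsub>?V\<^esub>"
      by (rule module_hom_inj_onD[OF V module_diag f(2,1) e])
    hence "fst e k = \<zero>" by simp
    thus False by (simp add: e_def)
  qed
  have fe_iso: "dot n (f e) (f e) = \<zero>"
    using Qf[OF e] qform_Eucl[OF fc[OF e]] qform_orth_sum_Null[OF S e] Q0 by (simp add: e_def)
  have orth: "dot n (f (h w)) (f e) = \<zero>" if w: "w \<in> carrier ?W" for w
  proof -
    let ?x = "f (h w)" and ?u = "f e"
    \<comment> \<open>Adding \<open>e\<close> does not change the form, so \<open>Q(x + u) = Q(x)\<close>; as \<open>Q(u) = 0\<close>, the mixed
      term \<open>2 B(x, u)\<close> vanishes.\<close>
    have sum: "h w \<oplus>\<^bsub>?V\<^esub> e \<in> carrier ?V"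
      using hc[OF w] e by (rule V.M.a_closed)
    have "dot n ?x ?x = qform ?V (h w)" using Qf[OF hc[OF w]] qform_Eucl[OF fc[OF hc[OF w]]] by simp
    also have "\<dots> = qform ?V (h w \<oplus>\<^bsub>?V\<^esub> e)"
      unfolding qform_orth_sum_Null[OF S hc[OF w]] qform_orth_sum_Null[OF S sum]
      using hc[OF w] by (simp add: e_def mem_Times_iff)
    also have "\<dots> = dot n (f (h w \<oplus>\<^bsub>?V\<^esub> e)) (f (h w \<oplus>\<^bsub>?V\<^esub> e))"
      using Qf[OF sum] qform_Eucl[OF fc[OF sum]] by simp
    also have "\<dots> = dot n (\<lambda>i. ?x i \<oplus> \<one> \<otimes> ?u i) (\<lambda>i. ?x i \<oplus> \<one> \<otimes> ?u i)"
      using ffun[OF e] ffun[OF hc[OF w]] module_hom_add[OF f(1) hc[OF w] e]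
      by (intro dot_cong) (auto simp: Pi_iff)
    also have "\<dots> = dot n ?x ?x \<oplus> ((\<one> \<oplus> \<one>) \<otimes> \<one> \<otimes> dot n ?x ?u \<oplus> \<one> \<otimes> \<one> \<otimes> dot n ?u ?u)"
      using ffun[OF e] ffun[OF hc[OF w]] by (intro dot_self_add_smult) auto
    finally have "dot n ?x ?x = dot n ?x ?x \<oplus> (\<one> \<oplus> \<one>) \<otimes> dot n ?x ?u"
      using ffun[OF e] ffun[OF hc[OF w]] fe_iso by simp
    hence "(\<one> \<oplus> \<one>) \<otimes> dot n ?x ?u = \<zero>"
      using ffun[OF e] ffun[OF hc[OF w]] by simp
    thus ?thesis
      using integral[of "\<one> \<oplus> \<one>" "dot n ?x ?u"] two_neq_zero ffun[OF e] ffun[OF hc[OF w]] by simp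
  qed
  obtain \<phi> where n: "2 \<le> n" and \<phi>: "\<phi> \<in> module_hom K (Eucl n) (Eucl (n - 2))"
    and Q\<phi>: "\<And>x. x \<in> carrier (Eucl n) \<Longrightarrow> dot n x (f e) = \<zero> \<Longrightarrow>
      qform (Eucl (n - 2)) (\<phi> x) = dot n x x"
    and ker\<phi>: "\<And>x. x \<in> carrier (Eucl n) \<Longrightarrow> dot n x (f e) = \<zero> \<Longrightarrow>
      \<phi> x = \<zero>\<^bsub>Eucl (n - 2)\<^esub> \<Longrightarrow> \<exists>c\<in>carrier K. x = c \<odot>\<^bsub>Eucl n\<^esub> f e"
    by (rule isotropic_quotient[OF fc[OF e] fe_nz fe_iso]) blast
  let ?g = "\<lambda>w. \<phi> (f (h w))"
  have g: "?g \<in> module_hom K ?W (Eucl (n - 2))"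
    by (rule module_hom_compose[OF module_hom_compose[OF h f(1)] \<phi>])
  have Qg: "qform (Eucl (n - 2)) (?g w) = qform ?W w" if w: "w \<in> carrier ?W" for w
    using Q\<phi>[OF fc[OF hc[OF w]] orth[OF w]] Qf[OF hc[OF w]] qform_Eucl[OF fc[OF hc[OF w]]]
      Qh[OF w] by simp
  have inj: "inj_on ?g (carrier ?W)"
  proof (rule module_hom_inj_onI[OF W module_diag g])
    fix w assume w: "w \<in> carrier ?W" and "?g w = \<zero>\<^bsub>Eucl (n - 2)\<^esub>"
    then obtain c where c: "c \<in> carrier K" "f (h w) = c \<odot>\<^bsub>Eucl n\<^esub> f e"
      using ker\<phi>[OF fc[OF hc[OF w]] orth[OF w]] by blast
    hence "f (h w) = f (c \<odot>\<^bsub>?V\<^esub> e)" using module_hom_smult[OF f(1) c(1) e] by simp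
    moreover have "c \<odot>\<^bsub>?V\<^esub> e \<in> carrier ?V" using c(1) e by (rule V.smult_closed)
    ultimately have hw: "h w = c \<odot>\<^bsub>?V\<^esub> e"
      using f(2) hc[OF w] by (meson inj_onD)
    obtain x s where xs: "w = (x, s)" by (cases w)
    have "c = \<zero>"
      using fun_cong[OF arg_cong[OF hw, of fst], of k] c(1) by (simp add: h_def e_def xs)
    hence "x i = \<zero>" if "i < k" for i
      using fun_cong[OF arg_cong[OF hw, of fst], of i] that by (simp add: h_def e_def xs)
    moreover have "s = \<zero>\<^bsub>S\<^esub>"
      using arg_cong[OF hw, of snd] c(1) by (simp add: h_def e_def xs)
    ultimately show "w = \<zero>\<^bsub>?W\<^esub>"
      using w by (auto simp: xs PiE_iff extensional_def fun_eq_iff)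
  qed
  show ?thesis unfolding embedded_def using n g Qg inj by blast
qed

text \<open>The additional null coordinate \<open>x\<close> is sent to \<open>(x, \<iota>x)\<close> in the two additional
  coordinates.\<close>

lemma embedded_Null_SucI:
  assumes S: "quadratic_space K S" and emb: "embedded K (orth_sum K (Null k) S) (Eucl n)"
  shows "embedded K (orth_sum K (Null (Suc k)) S) (Eucl (Suc (Suc n)))"
proof -
  interpret S: quadratic_space K S by fact
  let ?V = "orth_sum K (Null (Suc k)) S" and ?W = "orth_sum K (Null k) S" and ?n = "Suc (Suc n)"
  have V: "module K ?V" and W: "module K ?W"
    by (intro module_orth_sum module_diag S.module_axioms)+
  obtain f where f: "f \<in> module_hom K ?W (Eucl n)" "inj_on f (carrier ?W)"
    and Qf: "\<And>v. v \<in> carrier ?W \<Longrightarrow> qform (Eucl n) (f v) = qform ?W v"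
    using emb unfolding embedded_def by blast
  have fc: "f v \<in> carrier (Eucl n)" if "v \<in> carrier ?W" for v
    using module_hom_closed[OF f(1)] that by auto
  define r where "r = (\<lambda>(x :: nat \<Rightarrow> 'a, s :: 'b). (restrict x {..<k}, s))"
  have r: "r \<in> module_hom K ?V ?W"
  proof (rule module_homI)
    fix v assume "v \<in> carrier ?V"
    thus "r v \<in> carrier ?W"
      by (cases v) (simp add: r_def PiE_iff)
  next
    fix v w assume "v \<in> carrier ?V" "w \<in> carrier ?V"
    thus "r (v \<oplus>\<^bsub>?V\<^esub> w) = r v \<oplus>\<^bsub>?W\<^esub> r w"
      by (cases v; cases w) (simp add: r_def restrict_def fun_eq_iff)
  next
    fix c v assume "c \<in> carrier K" "v \<in> carrier ?V"
    thus "r (c \<odot>\<^bsub>?V\<^esub> v) = c \<odot>\<^bsub>?W\<^esub> r v"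
      by (cases v) (simp add: r_def restrict_def fun_eq_iff)
  qed
  have rc: "r v \<in> carrier ?W" if "v \<in> carrier ?V" for v
    using module_hom_closed[OF r] that by auto
  define g where "g = (\<lambda>v. \<lambda>i\<in>{..<?n}.
    if i < n then f (r v) i else if i = n then fst v k else \<iota> \<otimes> fst v k)"
  have vk: "fst v k \<in> carrier K" if "v \<in> carrier ?V" for v
    using that by (simp add: mem_Times_iff PiE_iff)
  have fri: "f (r v) i \<in> carrier K" if "v \<in> carrier ?V" "i < n" for v i
    using fc[OF rc[OF that(1)]] that(2) by (simp add: PiE_iff)
  have gc: "g v \<in> carrier (Eucl ?n)" if "v \<in> carrier ?V" for v
    using vk[OF that] fri[OF that] by (simp add: g_def)
  have g: "g \<in> module_hom K ?V (Eucl ?n)"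
  proof (rule module_homI[OF gc])
    fix v w assume v: "v \<in> carrier ?V" and w: "w \<in> carrier ?V"
    have "f (r (v \<oplus>\<^bsub>?V\<^esub> w)) = f (r v) \<oplus>\<^bsub>Eucl n\<^esub> f (r w)"
      using module_hom_add[OF r v w] module_hom_add[OF f(1) rc[OF v] rc[OF w]] by simp
    moreover have "fst (v \<oplus>\<^bsub>?V\<^esub> w) k = fst v k \<oplus> fst w k" by simp
    ultimately show "g (v \<oplus>\<^bsub>?V\<^esub> w) = g v \<oplus>\<^bsub>Eucl ?n\<^esub> g w"
      unfolding g_def using vk[OF v] vk[OF w] by (simp add: fun_eq_iff r_distr)
  next
    fix c v assume c: "c \<in> carrier K" and v: "v \<in> carrier ?V"
    have "f (r (c \<odot>\<^bsub>?V\<^esub> v)) = c \<odot>\<^bsub>Eucl n\<^esub> f (r v)"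
      using module_hom_smult[OF r c v] module_hom_smult[OF f(1) c rc[OF v]] by simp
    moreover have "fst (c \<odot>\<^bsub>?V\<^esub> v) k = c \<otimes> fst v k" by simp
    ultimately show "g (c \<odot>\<^bsub>?V\<^esub> v) = c \<odot>\<^bsub>Eucl ?n\<^esub> g v"
      unfolding g_def using vk[OF v] c by (simp add: fun_eq_iff m_lcomm)
  qed
  have Qg: "qform (Eucl ?n) (g v) = qform ?V v" if v: "v \<in> carrier ?V" for v
  proof -
    let ?x = "fst v k"
    have gf: "g v \<in> {..<?n} \<rightarrow> carrier K" "g v \<in> {..<Suc n} \<rightarrow> carrier K"
      using gc[OF v] by (simp_all add: PiE_iff Pi_iff)
    have fr: "f (r v) \<in> {..<n} \<rightarrow> carrier K" using fri[OF v] by simp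
    have eq: "dot n (g v) (g v) = dot n (f (r v)) (f (r v))"
      using fr by (intro dot_cong) (simp_all add: g_def)
    have d: "dot n (f (r v)) (f (r v)) \<in> carrier K"
      using fr fr by (rule dot_closed)
    have "qform (Eucl ?n) (g v) =
        (\<iota> \<otimes> ?x) \<otimes> (\<iota> \<otimes> ?x) \<oplus> (?x \<otimes> ?x \<oplus> dot n (f (r v)) (f (r v)))"
      unfolding qform_Eucl[OF gc[OF v]] dot_Suc[OF gf(1) gf(1)] dot_Suc[OF gf(2) gf(2)] eq
      by (simp add: g_def)
    also have "\<dots> = (\<iota> \<otimes> \<iota> \<oplus> \<one>) \<otimes> (?x \<otimes> ?x) \<oplus> dot n (f (r v)) (f (r v))"
      using vk[OF v] d i_closed by algebra
    also have "\<dots> = dot n (f (r v)) (f (r v))" using vk[OF v] d i_sq by simp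
    also have "\<dots> = qform ?W (r v)"
      using Qf[OF rc[OF v]] qform_Eucl[OF fc[OF rc[OF v]]] by simp
    also have "\<dots> = qform ?V v"
      unfolding qform_orth_sum_Null[OF S rc[OF v]] qform_orth_sum_Null[OF S v]
      by (simp add: r_def split: prod.splits)
    finally show ?thesis .
  qed
  have inj: "inj_on g (carrier ?V)"
  proof (rule module_hom_inj_onI[OF V module_diag g])
    fix v assume v: "v \<in> carrier ?V" and g0: "g v = \<zero>\<^bsub>Eucl ?n\<^esub>"
    have "f (r v) i = \<zero>" if "i < n" for i
      using fun_cong[OF g0, of i] that by (simp add: g_def)
    hence "f (r v) = \<zero>\<^bsub>Eucl n\<^esub>"
      using fc[OF rc[OF v]] by (auto simp: PiE_iff extensional_def fun_eq_iff)
    hence r0: "r v = \<zero>\<^bsub>?W\<^esub>"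
      by (rule module_hom_inj_onD[OF W module_diag f(2,1) rc[OF v]])
    obtain x s where xs: "v = (x, s)" by (cases v)
    have "x i = \<zero>" if "i < Suc k" for i
    proof (cases "i = k")
      case True
      thus ?thesis using fun_cong[OF g0, of n] by (simp add: g_def xs)
    next
      case False
      thus ?thesis using fun_cong[OF arg_cong[OF r0, of fst], of i] that by (simp add: r_def xs)
    qed
    moreover have "s = \<zero>\<^bsub>S\<^esub>" using arg_cong[OF r0, of snd] by (simp add: r_def xs)
    ultimately show "v = \<zero>\<^bsub>?V\<^esub>"
      using v by (auto simp: xs PiE_iff extensional_def fun_eq_iff)
  qed
  show ?thesis unfolding embedded_def using g Qg inj by blast
qed

lemma isometric_Null_0:
  assumes "quadratic_space K S"
  shows "isometric K (orth_sum K (Null 0) S) S"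
proof -
  interpret S: quadratic_space K S by fact
  have "snd \<in> module_hom K (orth_sum K (Null 0) S) S"
    by (auto simp: module_hom_def)
  moreover have "bij_betw snd (carrier (orth_sum K (Null 0) S)) (carrier S)"
    by (auto simp: bij_betw_def inj_on_def)
  moreover have "qform S (snd v) = qform (orth_sum K (Null 0) S) v"
    if "v \<in> carrier (orth_sum K (Null 0) S)" for v
    using qform_orth_sum_Null[OF assms that] by simp
  ultimately show ?thesis unfolding isometric_def by blast
qed

theorem embedded_Null_iff:
  assumes S: "quadratic_space K S"
  shows "embedded K (orth_sum K (Null k) S) (Eucl n) \<longleftrightarrow>
    2 * k \<le> n \<and> embedded K S (Eucl (n - 2 * k))"
proof (induction k arbitrary: n)
  case 0
  interpret S: quadratic_space K S by fact
  show ?case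
    using isometric_embedded_iff[OF module_orth_sum[OF module_diag S.module_axioms]
      isometric_Null_0[OF S], of "Eucl n"] by simp
next
  case (Suc k)
  have "embedded K (orth_sum K (Null (Suc k)) S) (Eucl n) \<longleftrightarrow>
      2 \<le> n \<and> embedded K (orth_sum K (Null k) S) (Eucl (n - 2))"
  proof -
    have "Suc (Suc (n - 2)) = n" if "2 \<le> n" using that by simp
    thus ?thesis
      using embedded_Null_Suc_imp[OF S, of k n] embedded_Null_SucI[OF S, of k "n - 2"] by metis
  qed
  also have "\<dots> \<longleftrightarrow> 2 * Suc k \<le> n \<and> embedded K S (Eucl (n - 2 * Suc k))"
    unfolding Suc.IH by auto
  finally show ?case .
qed

end

section \<open>A square root of -1 in the p-adic numbers\<close>

text \<open>In \<open>x\<^sup>p - y\<^sup>p = (x - y) \<Sum> y\<^sup>p\<^sup>-\<^sup>1\<^sup>-\<^sup>i x\<^sup>i\<close> the second factor has \<open>p\<close> terms, all congruent to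
  \<open>y\<^sup>p\<^sup>-\<^sup>1\<close> modulo \<open>p\<close>, and so contributes one more factor \<open>p\<close>.\<close>

lemma cong_power_prime_lift:
  fixes x y :: int
  assumes "[x = y] (mod int p ^ Suc m)"
  shows "[x ^ p = y ^ p] (mod int p ^ Suc (Suc m))"
proof -
  have d: "int p ^ Suc m dvd x - y"
    using assms by (simp add: cong_iff_dvd_diff)
  have "int p dvd x - y"
    using d by (meson dvd_trans dvd_power zero_less_Suc)
  hence xy: "[x = y] (mod int p)" by (simp add: cong_iff_dvd_diff)
  have "[(\<Sum>i<p. y ^ (p - Suc i) * x ^ i) = (\<Sum>i<p. y ^ (p - Suc i) * y ^ i)] (mod int p)"
    by (intro cong_sum cong_mult cong_pow cong_refl xy)
  also have "(\<Sum>i<p. y ^ (p - Suc i) * y ^ i) = (\<Sum>i<p. y ^ (p - 1))"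
    by (intro sum.cong) (auto simp flip: power_add)
  also have "\<dots> = int p * y ^ (p - 1)" by simp
  finally have "int p dvd (\<Sum>i<p. y ^ (p - Suc i) * x ^ i)"
    by (metis cong_dvd_iff dvd_triv_left)
  hence "int p ^ Suc m * int p dvd (x - y) * (\<Sum>i<p. y ^ (p - Suc i) * x ^ i)"
    using d by (rule mult_dvd_mono[rotated])
  thus ?thesis
    by (simp only: cong_iff_dvd_diff power_diff_sumr2 power_Suc2)
qed

lemma cong_power_prime_power_lift:
  fixes x y :: int
  assumes "[x = y] (mod int p)"
  shows "[x ^ (p ^ m) = y ^ (p ^ m)] (mod int p ^ Suc m)"
proof (induction m)
  case (Suc m)
  show ?case
    using cong_power_prime_lift[OF Suc] by (simp add: power_mult[symmetric] mult.commute)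
qed (use assms in simp)

lemma minus_one_quadratic_residue:
  assumes "prime p" "p mod 4 = (1::nat)"
  obtains a :: int where "[a\<^sup>2 = -1] (mod int p)"
proof -
  have p2: "p > 2" using assms prime_gt_1_nat[of p] by (cases "p = 2") auto
  have "even ((p - 1) div 2)" using assms(2) by presburger
  hence "[Legendre (-1) (int p) = 1] (mod int p)"
    using euler_criterion[OF assms(1) p2, of "-1"] by simp
  moreover have "\<not> int p dvd 1" "\<not> int p dvd 2"
    using p2 zdvd_not_zless[of 1 "int p"] zdvd_not_zless[of 2 "int p"] by auto
  ultimately have "QuadRes (int p) (-1)"
    unfolding Legendre_def by (auto simp: cong_iff_dvd_diff split: if_splits)
  thus thesis using that unfolding QuadRes_def by blast
qed

context
  fixes p :: nat
  assumes p: "prime p"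
begin

lemma padic_abs_of_int_le:
  assumes "int p ^ m dvd a"
  shows "padic_abs p (of_int a) \<le> 1 / real p ^ m"
proof (cases "a = 0")
  case False
  have "m \<le> multiplicity (int p) a"
    using assms False padic_prime_elem[OF p] by (intro multiplicity_geI) auto
  moreover have "padic_abs p (of_int a) = real p powi (- int (multiplicity (int p) a))"
    using padic_abs_frac[OF p False, of 1] by simp
  ultimately have "padic_abs p (of_int a) \<le> real p powi (- int m)"
    using padic_prime_gt_1[OF p] by (auto intro: power_int_increasing)
  thus ?thesis by (simp add: power_int_minus divide_simps)
qed (simp add: padic_abs_def)

lemma inverse_prime_power_lt:
  assumes "e > 0"
  shows "\<exists>N. \<forall>m\<ge>N. 1 / real p ^ m < e"
proof -
  have "(\<lambda>m. (1 / real p) ^ m) \<longlonglongrightarrow> 0"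
    using padic_prime_gt_1[OF p] by (intro LIMSEQ_realpow_zero) auto
  thus ?thesis using assms unfolding LIMSEQ_iff by (auto simp: power_one_over divide_simps)
qed

lemma Qp_zero: "\<zero>\<^bsub>Qp p\<^esub> = padic_null p"
  by (simp add: Qp_def FactRing_def)

text \<open>If \<open>a\<^sup>2 = -1\<close> modulo \<open>p\<close>, then \<open>a ^ (p ^ n)\<close> squares to \<open>-1\<close> modulo \<open>p ^ (n + 1)\<close>, because
  \<open>p\<close> is odd. Consecutive terms agree modulo \<open>p ^ (n + 1)\<close>, because \<open>a\<^sup>p = a\<close> modulo \<open>p\<close>. So the
  sequence is Cauchy, and its limit squares to \<open>-1\<close>.\<close>

lemma Qp_square_root_minus_one:
  assumes "p mod 4 = 1"
  obtains i where "i \<in> carrier (Qp p)" "i \<otimes>\<^bsub>Qp p\<^esub> i \<oplus>\<^bsub>Qp p\<^esub> \<one>\<^bsub>Qp p\<^esub> = \<zero>\<^bsub>Qp p\<^esub>"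
proof -
  obtain a :: int where a: "[a\<^sup>2 = -1] (mod int p)"
    using minus_one_quadratic_residue[OF p assms] .
  define t where "t = (\<lambda>n. a ^ (p ^ n))"
  have odd: "odd p" using assms by presburger
  have sq: "int p ^ Suc n dvd t n * t n + 1" for n
    using cong_power_prime_power_lift[OF a, of n] odd
    by (simp add: cong_iff_dvd_diff t_def power2_eq_square power_mult_distrib)
  have even: "even ((p - 1) div 2)" using assms by presburger
  have step: "int p ^ Suc n dvd t (Suc n) - t n" for n
  proof -
    have "a ^ (p - 1) = (a\<^sup>2) ^ ((p - 1) div 2)"
      using odd by (simp flip: power_mult)
    moreover have "[(a\<^sup>2) ^ ((p - 1) div 2) = (-1) ^ ((p - 1) div 2)] (mod int p)"
      using a by (rule cong_pow)
    ultimately have "[a ^ (p - 1) = 1] (mod int p)" using even by simp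
    hence "[a * a ^ (p - 1) = a * 1] (mod int p)" by (intro cong_mult cong_refl)
    hence "[a ^ p = a] (mod int p)"
      using p by (simp flip: power_Suc add: prime_gt_0_nat)
    from cong_power_prime_power_lift[OF this, of n] show ?thesis
      by (simp add: cong_iff_dvd_diff t_def flip: power_mult)
  qed
  have tele: "int p ^ Suc N dvd t m - t N" if "m \<ge> N" for m N
    using that
  proof (induction m rule: dec_induct)
    case (step m)
    have "int p ^ Suc N dvd int p ^ Suc m" using step by (intro le_imp_power_dvd) auto
    hence "int p ^ Suc N dvd (t (Suc m) - t m) + (t m - t N)"
      using \<open>int p ^ Suc m dvd t (Suc m) - t m\<close>[THEN [2] dvd_trans] step.IH by (intro dvd_add) auto
    thus ?case by simp
  qed simp
  define s :: "nat \<Rightarrow> rat" where "s = (\<lambda>n. of_int (t n))"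
  have cauchy: "padic_Cauchy p s"
    unfolding padic_Cauchy_def
  proof (intro allI impI)
    fix e :: real assume "e > 0"
    then obtain N where N: "\<And>m. m \<ge> N \<Longrightarrow> 1 / real p ^ m < e"
      using inverse_prime_power_lt by blast
    show "\<exists>N. \<forall>m\<ge>N. \<forall>n\<ge>N. padic_abs p (s m - s n) < e"
    proof (intro exI allI impI)
      fix m n assume "m \<ge> N" "n \<ge> N"
      hence "int p ^ Suc N dvd (t m - t N) - (t n - t N)" by (intro dvd_diff tele)
      hence "padic_abs p (of_int (t m - t n)) \<le> 1 / real p ^ Suc N"
        by (intro padic_abs_of_int_le) simp
      also have "\<dots> < e" by (rule N) simp
      finally show "padic_abs p (s m - s n) < e" by (simp add: s_def)
    qed
  qed
  have null: "(\<lambda>n. s n * s n + 1) \<in> padic_null p"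
    unfolding padic_null_iff[OF p]
  proof (intro allI impI)
    fix e :: real assume "e > 0"
    then obtain N where N: "\<And>m. m \<ge> N \<Longrightarrow> 1 / real p ^ m < e"
      using inverse_prime_power_lt by blast
    have "padic_abs p (s n * s n + 1) < e" if "n \<ge> N" for n
    proof -
      have "padic_abs p (of_int (t n * t n + 1)) \<le> 1 / real p ^ Suc n"
        by (rule padic_abs_of_int_le[OF sq])
      also have "\<dots> < e" using that by (intro N) simp
      finally show ?thesis by (simp add: s_def)
    qed
    thus "\<exists>N. \<forall>n\<ge>N. padic_abs p (s n * s n + 1) < e" by blast
  qed
  let ?R = "padic_Cauchy_ring p" and ?I = "padic_null p"
  interpret I: maximalideal ?I ?R by (rule maximalideal_padic_null[OF p])
  interpret h: ring_hom_ring ?R "Qp p" "(+>\<^bsub>?R\<^esub>) ?I"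
    unfolding Qp_def by (rule I.rcos_ring_hom_ring)
  have s: "s \<in> carrier ?R" using cauchy by (simp add: padic_Cauchy_ring_def)
  have "s \<otimes>\<^bsub>?R\<^esub> s \<oplus>\<^bsub>?R\<^esub> \<one>\<^bsub>?R\<^esub> = (\<lambda>n. s n * s n + 1)"
    by (simp add: padic_Cauchy_ring_def)
  hence "?I +>\<^bsub>?R\<^esub> (s \<otimes>\<^bsub>?R\<^esub> s \<oplus>\<^bsub>?R\<^esub> \<one>\<^bsub>?R\<^esub>) = \<zero>\<^bsub>Qp p\<^esub>"
    unfolding Qp_zero using null by (metis I.a_rcos_const)
  moreover have "?I +>\<^bsub>?R\<^esub> (s \<otimes>\<^bsub>?R\<^esub> s \<oplus>\<^bsub>?R\<^esub> \<one>\<^bsub>?R\<^esub>)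
    = (?I +>\<^bsub>?R\<^esub> s) \<otimes>\<^bsub>Qp p\<^esub> (?I +>\<^bsub>?R\<^esub> s) \<oplus>\<^bsub>Qp p\<^esub> \<one>\<^bsub>Qp p\<^esub>"
    using s by simp
  ultimately show thesis using h.hom_closed[OF s] by (intro that) simp_all
qed

lemma Qp_two_neq_zero: "\<one>\<^bsub>Qp p\<^esub> \<oplus>\<^bsub>Qp p\<^esub> \<one>\<^bsub>Qp p\<^esub> \<noteq> \<zero>\<^bsub>Qp p\<^esub>"
proof
  let ?R = "padic_Cauchy_ring p" and ?I = "padic_null p"
  interpret I: maximalideal ?I ?R by (rule maximalideal_padic_null[OF p])
  interpret h: ring_hom_ring ?R "Qp p" "(+>\<^bsub>?R\<^esub>) ?I"
    unfolding Qp_def by (rule I.rcos_ring_hom_ring)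
  assume "\<one>\<^bsub>Qp p\<^esub> \<oplus>\<^bsub>Qp p\<^esub> \<one>\<^bsub>Qp p\<^esub> = \<zero>\<^bsub>Qp p\<^esub>"
  hence "?I +>\<^bsub>?R\<^esub> (\<one>\<^bsub>?R\<^esub> \<oplus>\<^bsub>?R\<^esub> \<one>\<^bsub>?R\<^esub>) = \<zero>\<^bsub>Qp p\<^esub>" by simp
  hence "\<one>\<^bsub>?R\<^esub> \<oplus>\<^bsub>?R\<^esub> \<one>\<^bsub>?R\<^esub> \<in> ?I"
    unfolding Qp_zero by (rule I.rcos_const_imp_mem[rotated]) simp
  hence "(\<lambda>n. 2) \<in> ?I" by (simp add: padic_Cauchy_ring_def)
  hence "padic_abs p 2 = 0" by (simp add: padic_null_def LIMSEQ_const_iff)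
  thus False using padic_abs_eq_0[OF p, of 2] by simp
qed

end

section \<open>Degenerate spaces in sums of squares over the p-adic numbers\<close>

theorem theorem13:
  fixes p k n :: nat
    and A :: "(padic, 'a) quad"
    and S :: "(padic, 's) quad"
  assumes "prime p" and "p mod 4 = 1"
    and "quadratic_space (Qp p) A" and "degenerate (Qp p) A"
    and "quadratic_space (Qp p) S" and "nondegenerate (Qp p) S"
    and "isometric (Qp p) A
           (orth_sum (Qp p) (diag (Qp p) (replicate k \<zero>\<^bsub>Qp p\<^esub>)) S)"
    and "n > 0"
  shows "embedded (Qp p) A (diag (Qp p) (replicate n \<one>\<^bsub>Qp p\<^esub>)) \<longleftrightarrow>
         2 * k \<le> n \<and>
         embedded (Qp p) S (diag (Qp p) (replicate (n - 2 * k) \<one>\<^bsub>Qp p\<^esub>))"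
proof -
  interpret field "Qp p" using assms(1) by (rule field_Qp)
  obtain i where "i \<in> carrier (Qp p)" "i \<otimes>\<^bsub>Qp p\<^esub> i \<oplus>\<^bsub>Qp p\<^esub> \<one>\<^bsub>Qp p\<^esub> = \<zero>\<^bsub>Qp p\<^esub>"
    using Qp_square_root_minus_one[OF assms(1,2)] .
  then interpret field_with_i "Qp p" i
    using Qp_two_neq_zero[OF assms(1)] by unfold_locales
  interpret A: quadratic_space "Qp p" A by fact
  show ?thesis
    unfolding isometric_embedded_iff[OF A.module_axioms assms(7)]
    by (rule embedded_Null_iff[OF assms(5)])
qed

end
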